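(* For any integers $k,m,n$ satisfying $k\ge 1$, $m\ge 0$ and $n\ge k-1$, we have $$N_k(m,n)\ge N_k(m,n-1)$$ except when either $n=m+k$ or $$(k,m,n)\in\{(1,2,5),(1,3,10),(1,4,9),(1,6,13),(2,1,7),(2,0,8),(2,3,11),(3,0,9)\}.$$
   Context: For a positive integer $k$ and an integer $m$, the integers $N_k(m,n)$, $n\ge 0$, are defined by the power series identity $$\sum_{n=0}^{\infty}N_k(m,n)q^n=\frac{1}{(q;q)_\infty}\sum_{r=1}^{\infty}(-1)^{r-1}q^{r((2k-1)r-1)/2+|m|r}(1-q^r),$$ where $(q;q)_\infty=\prod_{i\ge 1}(1-q^i)$; and $N_k(m,n)=0$ for $n<0$. ($N_k(m,n)$ is the counting function of Garvan's $k$-rank; $k=1$ corresponds to the crank and $k=2$ to Dyson's rank.) *)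

theory Defs
  imports "HOL-Analysis.Analysis"
begin

text \<open>Infinite sums and products of formal power series are taken with respect to the usual
  (\<open>q\<close>-adic) metric on \<^typ>\<open>int fps\<close>, with \<open>fps_X\<close> in the role of \<open>q\<close>. The library sums and products
  start at index \<open>0\<close>, hence the shift by \<open>Suc\<close>.\<close>

definition qpoch_inf :: "int fps" where
  "qpoch_inf = prodinf (\<lambda>i. 1 - fps_X ^ Suc i)"

text \<open>The division by \<open>2\<close> in the exponent is exact, and the exponent is nonnegative for \<open>k \<ge> 1\<close>,
  \<open>r \<ge> 1\<close>; see \<open>krank_exponent_exact\<close> and \<open>krank_exponent_nonneg\<close>.\<close>

definition krank_term :: "int \<Rightarrow> int \<Rightarrow> nat \<Rightarrow> int fps" where
  "krank_term k m r =
     (-1) ^ (r - 1)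
     * fps_X ^ nat (int r * ((2 * k - 1) * int r - 1) div 2 + \<bar>m\<bar> * int r)
     * (1 - fps_X ^ r)"

text \<open>The ring \<^typ>\<open>int\<close> has no reciprocals in the sense of class \<^class>\<open>inverse\<close>, so the
  reciprocal of the series \<open>qpoch_inf\<close>, whose constant term is \<open>1\<close>, is expressed by
  \<^term>\<open>fps_right_inverse qpoch_inf 1\<close>; see \<open>qpoch_inf_times_inverse\<close>.\<close>

definition krank_gf :: "int \<Rightarrow> int \<Rightarrow> int fps" where
  "krank_gf k m = fps_right_inverse qpoch_inf 1 * (\<Sum>j. krank_term k m (Suc j))"

definition krank_N :: "int \<Rightarrow> int \<Rightarrow> int \<Rightarrow> int" where
  "krank_N k m n = (if n < 0 then 0 else fps_nth (krank_gf k m) (nat n))"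


subsection \<open>The defining sums and products converge, and the identity characterises \<open>krank_N\<close>\<close>

lemma krank_exponent_exact: "2 dvd r * ((2 * k - 1) * r - 1)" for k r :: int
  by (cases "even r") auto

lemma krank_exponent_ge:
  fixes k m :: int
  assumes "k \<ge> 1"
  shows "int j \<le> int (Suc j) * ((2 * k - 1) * int (Suc j) - 1) div 2 + \<bar>m\<bar> * int (Suc j)"
proof -
  define r where "r = int (Suc j)"
  have r: "int j = r - 1" "r \<ge> 1" by (simp_all add: r_def)
  have "1 * r \<le> (2 * k - 1) * r"
    using assms r(2) by (intro mult_right_mono) auto
  hence "r - 1 \<le> (2 * k - 1) * r - 1" by simp
  hence "r * (r - 1) \<le> r * ((2 * k - 1) * r - 1)"
    using r(2) by (intro mult_left_mono) auto
  moreover have "2 * (r - 1) \<le> r * (r - 1)"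
  proof (cases "r = 1")
    case False
    thus ?thesis using r(2) by (intro mult_right_mono) auto
  qed simp
  ultimately have "2 * (r - 1) \<le> r * ((2 * k - 1) * r - 1)" by (rule order_trans[rotated])
  hence "r - 1 \<le> r * ((2 * k - 1) * r - 1) div 2"
    using zdiv_mono1[of "2 * (r - 1)" _ 2] by simp
  moreover have "0 \<le> \<bar>m\<bar> * r" using r(2) by simp
  ultimately have "r - 1 \<le> r * ((2 * k - 1) * r - 1) div 2 + \<bar>m\<bar> * r"
    by (metis add_increasing2)
  thus ?thesis unfolding r(1) r_def .
qed

lemma krank_exponent_nonneg:
  fixes k m :: int
  assumes "k \<ge> 1" "r \<ge> (1 :: nat)"
  shows "0 \<le> int r * ((2 * k - 1) * int r - 1) div 2 + \<bar>m\<bar> * int r"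
proof -
  obtain j where "r = Suc j" using assms(2) by (cases r) auto
  thus ?thesis
    using krank_exponent_ge[OF assms(1), of j m] of_nat_0_le_iff[of j]
    by (metis order_trans)
qed

lemma krank_term_nth_eq_0:
  assumes "k \<ge> 1" "n < j"
  shows "fps_nth (krank_term k m (Suc j)) n = 0"
proof -
  define e where "e = nat (int (Suc j) * ((2 * k - 1) * int (Suc j) - 1) div 2 + \<bar>m\<bar> * int (Suc j))"
  have "j \<le> e"
    unfolding e_def using krank_exponent_ge[OF assms(1), of j m] by linarith
  with assms(2) have "n < e" by simp
  moreover have "krank_term k m (Suc j) = fps_X ^ e * ((-1) ^ j * (1 - fps_X ^ Suc j))"
    unfolding krank_term_def e_def by (simp only: diff_Suc_1 mult_ac)
  ultimately show ?thesis
    by (simp only: fps_X_power_mult_nth if_True)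
qed

lemma summable_krank_term:
  assumes "k \<ge> 1"
  shows "summable (\<lambda>j. krank_term k m (Suc j))"
proof -
  let ?f = "\<lambda>j. krank_term k m (Suc j)"
  define S where "S = Abs_fps (\<lambda>n. fps_nth (\<Sum>j<Suc n. ?f j) n)"
  have "(\<lambda>N. \<Sum>j<N. ?f j) \<longlonglongrightarrow> S"
  proof (rule tendsto_fpsI)
    fix n
    show "\<forall>\<^sub>F N in sequentially. fps_nth (\<Sum>j<N. ?f j) n = fps_nth S n"
      using eventually_ge_at_top[of "Suc n"]
    proof eventually_elim
      case (elim N)
      have "(\<Sum>j<N. fps_nth (?f j) n) = (\<Sum>j<Suc n. fps_nth (?f j) n)"
        using elim by (intro sum.mono_neutral_right) (auto simp: krank_term_nth_eq_0[OF assms])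
      thus ?case by (simp add: S_def fps_sum_nth)
    qed
  qed
  thus ?thesis by (auto simp: summable_def sums_def)
qed

lemma qpoch_partial_nth:
  assumes "n \<le> N"
  shows "fps_nth (\<Prod>i\<le>N. 1 - fps_X ^ Suc i :: int fps) n
       = fps_nth (\<Prod>i\<le>n. 1 - fps_X ^ Suc i :: int fps) n"
  using assms
proof (induction rule: dec_induct)
  case (step N)
  let ?P = "\<Prod>i\<le>N. 1 - fps_X ^ Suc i :: int fps"
  have "(\<Prod>i\<le>Suc N. 1 - fps_X ^ Suc i :: int fps) = ?P - fps_X ^ Suc (Suc N) * ?P"
    by (simp only: prod.atMost_Suc ring_distribs mult_1_left mult_1_right mult.commute)
  hence "fps_nth (\<Prod>i\<le>Suc N. 1 - fps_X ^ Suc i :: int fps) n = fps_nth ?P n"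
    using step.hyps by (simp only: fps_sub_nth fps_X_power_mult_nth) simp
  thus ?case using step.IH by simp
qed simp

lemma qpoch_inf_aux:
  shows has_prod_qpoch_inf: "(\<lambda>i. 1 - fps_X ^ Suc i) has_prod qpoch_inf"
    and qpoch_inf_nth_0: "fps_nth qpoch_inf 0 = 1"
proof -
  let ?f = "\<lambda>i. 1 - fps_X ^ Suc i :: int fps"
  define P where "P = Abs_fps (\<lambda>n. fps_nth (\<Prod>i\<le>n. ?f i) n)"
  have lim: "(\<lambda>N. \<Prod>i\<le>N. ?f i) \<longlonglongrightarrow> P"
  proof (rule tendsto_fpsI)
    fix n
    show "\<forall>\<^sub>F N in sequentially. fps_nth (\<Prod>i\<le>N. ?f i) n = fps_nth P n"
      using eventually_ge_at_top[of n]
      unfolding P_def fps_nth_Abs_fps by eventually_elim (rule qpoch_partial_nth)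
  qed
  have P0: "fps_nth P 0 = 1" by (simp add: P_def)
  hence "P \<noteq> 0" by auto
  with lim have hp: "?f has_prod P"
    unfolding has_prod_def raw_has_prod_def by simp
  hence "qpoch_inf = P"
    unfolding qpoch_inf_def by (rule has_prod_unique[symmetric])
  with hp P0 show "?f has_prod qpoch_inf" "fps_nth qpoch_inf 0 = 1" by simp_all
qed

lemma qpoch_inf_times_inverse: "qpoch_inf * fps_right_inverse qpoch_inf 1 = 1"
  by (rule fps_right_inverse) (simp add: qpoch_inf_nth_0)

lemma krank_gf_identity:
  "F = krank_gf k m \<longleftrightarrow> qpoch_inf * F = (\<Sum>j. krank_term k m (Suc j))"
proof -
  have eq: "qpoch_inf * krank_gf k m = (\<Sum>j. krank_term k m (Suc j))"
    by (simp only: krank_gf_def mult.assoc[symmetric] qpoch_inf_times_inverse mult_1_left)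
  have "qpoch_inf \<noteq> 0" using qpoch_inf_nth_0 by auto
  hence "qpoch_inf * F = qpoch_inf * krank_gf k m \<longleftrightarrow> F = krank_gf k m"
    by (rule mult_left_cancel)
  thus ?thesis unfolding eq by (rule sym)
qed

lemma Abs_fps_krank_N: "Abs_fps (\<lambda>n. krank_N k m (int n)) = krank_gf k m"
  by (rule fps_ext) (simp add: krank_N_def)

end

theory Submission
  imports Defs
begin

text \<open>
  Multiplying the generating function of \<open>N_k(m, n)\<close> by \<open>1 - q\<close> produces the differences whose
  signs are asked for. A series \<open>1 / (q)_n\<close> with \<open>n \<ge> 1\<close> stays nonnegative under this
  multiplication, since \<open>(1 - q) / (q)_n\<close> merely forbids the part \<open>1\<close>. So the generating function
  is rewritten as a sum of products of nonnegative series, and only the few terms without a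
  denominator that can absorb \<open>1 - q\<close> need attention.

  For \<open>k \<ge> 2\<close> such a sum comes from a Bailey chain (\<open>krank_gf_bailey_chain\<close>): it runs over
  \<open>n_1 \<ge> \<dots> \<ge> n_(k-1) \<ge> 1\<close>, with terms
  \<open>q ^ (n_1\<^sup>2 + \<dots> + n_(k-1)\<^sup>2) * \<beta>_(n_(k-1)) / ((q)_(n_1 - n_2) \<dots> (q)_(n_(k-2) - n_(k-1)))\<close>,
  where \<open>\<beta>_N\<close> is the coefficient of \<open>z ^ m\<close> in \<open>1 / ((zq)_N (q/z)_N)\<close>. A strict descent absorbs
  \<open>1 - q\<close>, which leaves the constant chains and their contributions
  \<open>q ^ ((k - 1) * N\<^sup>2) * (1 - q) * \<beta>_N\<close>. The product over \<open>z\<close> gives a three-term recurrence that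
  carries positivity from \<open>N\<close> to \<open>N + 1\<close> (\<open>three_term_positivity\<close>), starting with an explicit
  formula at \<open>N = 2\<close>. Thus for \<open>N \<ge> 2\<close> the contribution is nonnegative, except that for \<open>m = 0\<close>
  its coefficient at \<open>n = (k - 1) * N\<^sup>2 + 1\<close> may be \<open>-1\<close> (\<open>beta_diff_0_bounds\<close>). For \<open>N = 1\<close> it is
  \<open>q ^ (k - 1 + m) / (1 + q)\<close>. Its first negative coefficient is the exception \<open>n = m + k\<close>. The
  others are cancelled by the chain \<open>(2, 1, \<dots>, 1)\<close> if \<open>k \<ge> 3\<close>, and by \<open>N = 2\<close> if \<open>k = 2\<close>, up to
  sporadic exceptions. Further chains compensate the coefficients \<open>-1\<close> for \<open>m = 0\<close>, with the single
  exception of \<open>k = 3\<close> and \<open>n = 9\<close>.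

  For \<open>k = 1\<close> the generating function is \<open>\<Sum>j. (1 - q) * q ^ (j + (j + 1) * (j + m)) / ((q)_j (q)_(j + m))\<close>
  (\<open>crank_gf\<close>), because both sides satisfy the same functional equation in \<open>m\<close>. After
  multiplication by \<open>1 - q\<close> the terms with \<open>j \<ge> 1\<close> are nonnegative, and for \<open>m \<ge> 1\<close> the term \<open>j = 0\<close>
  is \<open>q ^ m * (1 - q) / ((1 - q\<^sup>2) \<dots> (1 - q ^ m))\<close>. For \<open>m \<in> {1, 5}\<close> and for \<open>m \<ge> 7\<close> its only
  negative coefficient is the one at \<open>n = m + 1\<close>, by induction on \<open>m\<close> (\<open>crank_head_large\<close>), while for
  \<open>m \<in> {2, 3, 4, 6}\<close> the term \<open>j = 1\<close> compensates the others up to one sporadic exception for each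
  of these \<open>m\<close>.
\<close>

section \<open>Power series with nonnegative coefficients and congruences modulo powers of \<open>q\<close>\<close>

abbreviation q :: "int fps" where "q \<equiv> fps_X"

definition fps_nonneg :: "int fps \<Rightarrow> bool" where
  "fps_nonneg f \<longleftrightarrow> (\<forall>n. 0 \<le> fps_nth f n)"

lemma fps_nonnegD: "fps_nonneg f \<Longrightarrow> 0 \<le> fps_nth f n"
  by (simp add: fps_nonneg_def)

lemma fps_nonneg_add: "fps_nonneg f \<Longrightarrow> fps_nonneg g \<Longrightarrow> fps_nonneg (f + g)"
  by (simp add: fps_nonneg_def)

lemma fps_nonneg_mult: "fps_nonneg f \<Longrightarrow> fps_nonneg g \<Longrightarrow> fps_nonneg (f * g)"
  by (simp add: fps_nonneg_def fps_mult_nth sum_nonneg)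

lemma fps_nonneg_one: "fps_nonneg 1"
  by (simp add: fps_nonneg_def)

lemma fps_nonneg_zero: "fps_nonneg 0"
  by (simp add: fps_nonneg_def)

lemma fps_nonneg_X: "fps_nonneg q"
  by (simp add: fps_nonneg_def fps_X_def)

lemma fps_nonneg_power: "fps_nonneg f \<Longrightarrow> fps_nonneg (f ^ n)"
  by (induction n) (auto intro: fps_nonneg_mult fps_nonneg_one)

lemma fps_nonneg_sum: "(\<And>x. x \<in> A \<Longrightarrow> fps_nonneg (f x)) \<Longrightarrow> fps_nonneg (sum f A)"
  by (simp add: fps_nonneg_def fps_sum_nth sum_nonneg)

lemma fps_nonneg_prod: "(\<And>x. x \<in> A \<Longrightarrow> fps_nonneg (f x)) \<Longrightarrow> fps_nonneg (prod f A)"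
  by (induction A rule: infinite_finite_induct) (auto intro: fps_nonneg_mult fps_nonneg_one)

definition geo :: "nat \<Rightarrow> int fps" where
  "geo i = Abs_fps (\<lambda>n. if i dvd n then 1 else 0)"

lemma geo_nth: "fps_nth (geo i) n = (if i dvd n then 1 else 0)"
  by (simp add: geo_def)

lemma geo_inverse: "i > 0 \<Longrightarrow> (1 - q ^ i) * geo i = 1"
  by (rule fps_ext)
     (auto simp: left_diff_distrib fps_X_power_mult_nth geo_nth dvd_minus_self dest: nat_dvd_not_less)

lemma fps_nonneg_geo: "fps_nonneg (geo i)"
  by (simp add: fps_nonneg_def geo_nth)

lemmas fps_nonneg_intros = fps_nonneg_add fps_nonneg_mult fps_nonneg_one fps_nonneg_zero
  fps_nonneg_X fps_nonneg_power fps_nonneg_sum fps_nonneg_prod fps_nonneg_geo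

text \<open>Congruence of series modulo \<open>q ^ n\<close> is stated as divisibility of the difference: it
  then interacts with products and finite sums through the library's divisibility rules,
  and it replaces limits of infinite sums throughout.\<close>

lemma X_power_dvd_iff: "q ^ n dvd f \<longleftrightarrow> (\<forall>i<n. fps_nth f i = 0)"
proof
  assume "\<forall>i<n. fps_nth f i = 0"
  hence "f = q ^ n * Abs_fps (\<lambda>i. fps_nth f (i + n))"
    by (intro fps_ext) (simp add: fps_X_power_mult_nth)
  thus "q ^ n dvd f" by (metis dvd_triv_left)
qed (auto simp: dvd_def fps_X_power_mult_nth)

lemma X_cong_nth: "q ^ n dvd f - g \<Longrightarrow> i < n \<Longrightarrow> fps_nth f i = fps_nth g i"
  by (auto simp: X_power_dvd_iff)

lemma X_cong_sym: "q ^ n dvd f - g \<Longrightarrow> q ^ n dvd g - f"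
  by (auto simp: X_power_dvd_iff)

lemma X_cong_trans: "q ^ n dvd f - g \<Longrightarrow> q ^ n dvd g - h \<Longrightarrow> q ^ n dvd f - h"
  by (auto simp: X_power_dvd_iff)

lemma X_cong_sum:
  "(\<And>x. x \<in> A \<Longrightarrow> q ^ n dvd f x - g x) \<Longrightarrow> q ^ n dvd sum f A - sum g A"
  by (simp add: sum_subtractf[symmetric] dvd_sum)

lemma one_minus_X_power_nonzero: "i > 0 \<Longrightarrow> 1 - q ^ i \<noteq> 0"
  using geo_inverse[of i] by (metis mult_zero_left zero_neq_one)

section \<open>Reciprocal \<open>q\<close>-Pochhammer symbols and Durfee rectangles\<close>

definition poch :: "nat \<Rightarrow> int fps" where "poch n = (\<Prod>i<n. 1 - q ^ Suc i)"
definition ipoch :: "nat \<Rightarrow> int fps" where "ipoch n = (\<Prod>i<n. geo (Suc i))"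
definition ipoch_inf :: "int fps" where "ipoch_inf = fps_right_inverse qpoch_inf 1"

lemma ipoch_0 [simp]: "ipoch 0 = 1" by (simp add: ipoch_def)
lemma ipoch_Suc: "ipoch (Suc n) = ipoch n * geo (Suc n)" by (simp add: ipoch_def)

lemma ipoch_eq: "ipoch n = (1 - q ^ Suc n) * ipoch (Suc n)"
proof -
  have "(1 - q ^ Suc n) * ipoch (Suc n) = ipoch n * ((1 - q ^ Suc n) * geo (Suc n))"
    by (simp only: ipoch_Suc mult_ac)
  thus ?thesis by (simp only: geo_inverse zero_less_Suc mult_1_right)
qed

lemma fps_nonneg_ipoch: "fps_nonneg (ipoch n)"
  unfolding ipoch_def by (intro fps_nonneg_intros)

lemma poch_ipoch: "poch n * ipoch n = 1"
proof -
  have "poch n * ipoch n = (\<Prod>i<n. (1 - q ^ Suc i) * geo (Suc i))"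
    by (simp only: poch_def ipoch_def prod.distrib)
  thus ?thesis by (simp only: geo_inverse zero_less_Suc prod.neutral_const)
qed

lemma qpoch_inf_nth: "i < n \<Longrightarrow> fps_nth qpoch_inf i = fps_nth (poch n) i"
proof -
  assume i: "i < n"
  have "(\<lambda>N. \<Prod>j\<le>N. 1 - q ^ Suc j) \<longlonglongrightarrow> qpoch_inf"
    by (rule has_prod_imp_tendsto[OF has_prod_qpoch_inf])
  hence "\<forall>\<^sub>F N in sequentially. fps_nth (\<Prod>j\<le>N. 1 - q ^ Suc j) i = fps_nth qpoch_inf i"
    unfolding tendsto_fps_iff by blast
  then obtain N0 where "\<forall>N\<ge>N0. fps_nth (\<Prod>j\<le>N. 1 - q ^ Suc j) i = fps_nth qpoch_inf i"
    unfolding eventually_sequentially by blast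
  hence "fps_nth (\<Prod>j\<le>max i N0. 1 - q ^ Suc j) i = fps_nth qpoch_inf i"
    by (meson max.cobounded2)
  hence "fps_nth qpoch_inf i = fps_nth (\<Prod>j\<le>i. 1 - q ^ Suc j) i"
    by (metis max.cobounded1 qpoch_partial_nth)
  also have "\<dots> = fps_nth (\<Prod>j\<le>n-1. 1 - q ^ Suc j) i"
    using i by (intro qpoch_partial_nth[symmetric]) auto
  also have "{..n-1} = {..<n}" using i by auto
  finally show ?thesis by (simp only: poch_def)
qed

lemma poch_cong: "n \<le> N \<Longrightarrow> q ^ n dvd poch N - poch n"
  unfolding X_power_dvd_iff by (metis diff_self fps_sub_nth order_less_le_trans qpoch_inf_nth)

lemma ipoch_cong: "n \<le> N \<Longrightarrow> q ^ n dvd ipoch_inf - ipoch N"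
proof -
  assume "n \<le> N"
  hence "q ^ n dvd q ^ N" by (rule le_imp_power_dvd)
  have "q ^ N dvd poch N - qpoch_inf"
    unfolding X_power_dvd_iff by (simp add: qpoch_inf_nth[of _ N])
  moreover have "ipoch_inf - ipoch N = ipoch_inf * ipoch N * (poch N - qpoch_inf)"
    using qpoch_inf_times_inverse poch_ipoch[of N] unfolding ipoch_inf_def by algebra
  ultimately have "q ^ N dvd ipoch_inf - ipoch N" by simp
  with \<open>q ^ n dvd q ^ N\<close> show ?thesis by (rule dvd_trans)
qed

text \<open>A finite form of the Durfee rectangle identity and a case of the \<open>q\<close>-Vandermonde sum.
  The factor \<open>1 - q ^ (L + 1) = (1 - q ^ i) + q ^ i * (1 - q ^ (L + 1 - i))\<close> splits the sum
  for \<open>L + 1\<close> into two sums for \<open>L\<close> that recombine to the sum for \<open>L\<close> and \<open>a + 1\<close>.\<close>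

lemma durfee_finite:
  "(\<Sum>i\<le>L. q ^ (i * (i + a)) * ipoch (L - i) * ipoch i * ipoch (i + a)) = ipoch L * ipoch (L + a)"
proof (induction L arbitrary: a)
  case (Suc L)
  have aux: "w * x * y * u * v * z + w * x * u * v * ((1 - y) * z) = w * x * u * v * z"
    for u v w x y z :: "int fps"
    by algebra
  define F where "F i = q ^ (i * (i + a)) * ipoch (Suc L - i) * ipoch i * ipoch (i + a)" for i
  have "(1 - q ^ Suc L) * (\<Sum>i\<le>Suc L. F i) =
      (\<Sum>i\<le>Suc L. (1 - q ^ i) * F i) + (\<Sum>i\<le>Suc L. q ^ i * (1 - q ^ (Suc L - i)) * F i)"
    unfolding sum_distrib_left sum.distrib[symmetric]
  proof (rule sum.cong[OF refl])
    fix i assume "i \<in> {..Suc L}"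
    hence "q ^ Suc L = q ^ i * q ^ (Suc L - i)" by (simp add: power_add[symmetric])
    moreover have "(1 - x * y) * z = (1 - x) * z + x * (1 - y) * z" for x y z :: "int fps"
      by algebra
    ultimately show "(1 - q ^ Suc L) * F i = (1 - q ^ i) * F i + q ^ i * (1 - q ^ (Suc L - i)) * F i"
      by metis
  qed
  also have "(\<Sum>i\<le>Suc L. (1 - q ^ i) * F i) = (\<Sum>i\<le>L. (1 - q ^ Suc i) * F (Suc i))"
    by (subst sum.atMost_Suc_shift) simp
  also have "(\<Sum>i\<le>Suc L. q ^ i * (1 - q ^ (Suc L - i)) * F i) =
      (\<Sum>i\<le>L. q ^ i * (1 - q ^ (Suc L - i)) * F i)"
    by simp
  also have "(\<Sum>i\<le>L. (1 - q ^ Suc i) * F (Suc i)) + \<dots> =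
      (\<Sum>i\<le>L. q ^ (i * (i + Suc a)) * ipoch (L - i) * ipoch i * ipoch (i + Suc a))"
    unfolding sum.distrib[symmetric]
  proof (rule sum.cong[OF refl])
    fix i assume "i \<in> {..L}"
    hence i: "Suc L - i = Suc (L - i)" by auto
    have e: "q ^ (Suc i * (Suc i + a)) = q ^ (i * (i + a)) * q ^ i * q ^ Suc (i + a)"
      "q ^ (i * (i + Suc a)) = q ^ (i * (i + a)) * q ^ i"
      by (simp_all add: power_add[symmetric] algebra_simps del: power_Suc)
    have "(1 - q ^ Suc i) * F (Suc i) =
        q ^ (i * (i + a)) * q ^ i * q ^ Suc (i + a) * ipoch (L - i) * ipoch i * ipoch (Suc (i + a))"
      unfolding F_def e using ipoch_eq[of i] by (simp add: mult_ac del: power_Suc)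
    moreover have "q ^ i * (1 - q ^ (Suc L - i)) * F i =
        q ^ (i * (i + a)) * q ^ i * ipoch (L - i) * ipoch i * ((1 - q ^ Suc (i + a)) * ipoch (Suc (i + a)))"
      unfolding F_def i ipoch_eq[of "L - i"] ipoch_eq[of "i + a"]
      by (simp only: mult_ac)
    ultimately show "(1 - q ^ Suc i) * F (Suc i) + q ^ i * (1 - q ^ (Suc L - i)) * F i =
        q ^ (i * (i + Suc a)) * ipoch (L - i) * ipoch i * ipoch (i + Suc a)"
      by (simp only: e(2)[unfolded add_Suc_right] add_Suc_right aux)
  qed
  also have "\<dots> = ipoch L * ipoch (L + Suc a)" by (rule Suc.IH)
  also have "\<dots> = (1 - q ^ Suc L) * (ipoch (Suc L) * ipoch (Suc L + a))"
    by (simp only: ipoch_eq[of L] mult_ac add_Suc_right add_Suc)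
  finally have "(\<Sum>i\<le>Suc L. F i) = ipoch (Suc L) * ipoch (Suc L + a)"
    using mult_left_cancel[OF one_minus_X_power_nonzero[of "Suc L"]] by blast
  thus ?case by (simp only: F_def)
qed simp

text \<open>Let \<open>L\<close> tend to infinity in the finite identity: \<open>(q)_L / (q)_(L - i)\<close> is \<open>1\<close> up to
  order \<open>L - i\<close>, and the factor \<open>q ^ (i * (i + a))\<close> supplies the missing \<open>i\<close>.\<close>

lemma durfee_limit:
  "q ^ L dvd (\<Sum>i\<le>L. q ^ (i * (i + a)) * ipoch i * ipoch (i + a)) - ipoch_inf"
proof -
  let ?f = "\<lambda>i. q ^ (i * (i + a)) * ipoch i * ipoch (i + a)"
  have aux: "x * y - c * (x * y * z) = x * (y * z) * (p - c)" if "p * z = 1" for x y z p c :: "int fps"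
    using that by algebra
  have "q ^ L dvd (\<Sum>i\<le>L. ?f i) - (\<Sum>i\<le>L. poch L * (?f i * ipoch (L - i)))"
  proof (rule X_cong_sum)
    fix i assume "i \<in> {..L}"
    hence i: "i \<le> L" by simp
    have "?f i - poch L * (?f i * ipoch (L - i)) =
        q ^ (i * (i + a)) * (ipoch i * ipoch (i + a) * ipoch (L - i)) * (poch (L - i) - poch L)"
      using aux[where x = "q ^ (i * (i + a))" and y = "ipoch i * ipoch (i + a)" and c = "poch L", OF poch_ipoch[of "L - i"]] by (simp only: mult_ac)
    moreover have "q ^ (L - i) dvd poch (L - i) - poch L"
      by (rule X_cong_sym[OF poch_cong]) simp
    ultimately have "q ^ (i * (i + a)) * q ^ (L - i) dvd ?f i - poch L * (?f i * ipoch (L - i))"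
      by (simp add: mult_dvd_mono)
    moreover have "L \<le> i * (i + a) + (L - i)"
      using i by (cases i) auto
    hence "q ^ L dvd q ^ (i * (i + a)) * q ^ (L - i)"
      unfolding power_add[symmetric] by (rule le_imp_power_dvd)
    ultimately show "q ^ L dvd ?f i - poch L * (?f i * ipoch (L - i))"
      using dvd_trans by blast
  qed
  also have "(\<Sum>i\<le>L. poch L * (?f i * ipoch (L - i))) = poch L * (ipoch L * ipoch (L + a))"
    unfolding sum_distrib_left[symmetric] durfee_finite[symmetric] by (simp only: mult_ac)
  also have "\<dots> = ipoch (L + a)"
    using poch_ipoch[of L] by (simp add: mult.assoc[symmetric])
  finally have "q ^ L dvd (\<Sum>i\<le>L. ?f i) - ipoch (L + a)" .
  moreover have "q ^ L dvd ipoch (L + a) - ipoch_inf"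
    by (rule X_cong_sym[OF ipoch_cong]) simp
  ultimately show ?thesis by (rule X_cong_trans)
qed

section \<open>A Bailey chain for the generating function of the \<open>k\<close>-rank\<close>

text \<open>The defining sum of the \<open>k\<close>-rank has the terms \<open>q ^ ((k - 1) * r\<^sup>2) * \<alpha>_r\<close> with an
  \<open>\<alpha>_r\<close> that does not depend on \<open>k\<close>; the dependence on \<open>k\<close> is that of a Bailey chain with
  \<open>a = 1\<close>.\<close>

definition bailey_alpha :: "nat \<Rightarrow> nat \<Rightarrow> int fps" where
  "bailey_alpha r m = (-1) ^ (r - 1) * q ^ (r * (r - 1) div 2 + m * r) * (1 - q ^ r)"

text \<open>The Bailey partner of \<open>q ^ (i * r\<^sup>2) * \<alpha>_r\<close>. For \<open>i = 0\<close> and \<open>N \<ge> 1\<close> it is the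
  coefficient of \<open>z ^ m\<close> in \<open>1 / ((zq)_N (q/z)_N)\<close>, and the recurrence in \<open>N\<close> below
  reflects this product.\<close>

definition bailey_beta :: "nat \<Rightarrow> nat \<Rightarrow> nat \<Rightarrow> int fps" where
  "bailey_beta i N m = (\<Sum>r\<in>{1..N}. q ^ (i * (r * r)) * bailey_alpha r m * ipoch (N - r) * ipoch (N + r))"

lemma krank_term_bailey_alpha:
  assumes "r \<ge> 1"
  shows "krank_term (int (Suc i)) (int m) r = q ^ (i * (r * r)) * bailey_alpha r m"
proof -
  have "even (r * (r - 1))" by (cases r) auto
  then obtain t where t: "r * (r - 1) = 2 * t" by (elim evenE)
  have "int r * (int r - 1) = 2 * int t"
    using t assms by (metis of_nat_1 of_nat_diff of_nat_mult of_nat_numeral)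
  moreover have "int r * ((2 * int (Suc i) - 1) * int r - 1) =
      2 * int (i * (r * r)) + int r * (int r - 1)"
    by (simp add: algebra_simps)
  ultimately have "int r * ((2 * int (Suc i) - 1) * int r - 1) = 2 * int (i * (r * r) + t)"
    by simp
  hence "int r * ((2 * int (Suc i) - 1) * int r - 1) div 2 + \<bar>int m\<bar> * int r
      = int (i * (r * r) + t + m * r)"
    by simp
  hence "nat (int r * ((2 * int (Suc i) - 1) * int r - 1) div 2 + \<bar>int m\<bar> * int r)
      = i * (r * r) + (r * (r - 1) div 2 + m * r)"
    unfolding t by (simp del: of_nat_add of_nat_mult)
  thus ?thesis
    unfolding krank_term_def bailey_alpha_def by (simp add: power_add mult_ac)
qed

text \<open>Truncating the defining sum after \<open>J\<close> terms changes no coefficient below \<open>q ^ J\<close>.\<close>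

lemma krank_gf_cong:
  "q ^ J dvd krank_gf (int (Suc i)) (int m)
     - ipoch_inf * (\<Sum>r\<in>{1..J}. q ^ (i * (r * r)) * bailey_alpha r m)"
proof -
  let ?f = "\<lambda>j. krank_term (int (Suc i)) (int m) (Suc j)"
  have "q ^ J dvd suminf ?f - (\<Sum>j<J. ?f j)"
    unfolding X_power_dvd_iff
  proof (intro allI impI)
    fix n assume n: "n < J"
    have "(\<lambda>N. \<Sum>j<N. ?f j) \<longlonglongrightarrow> suminf ?f"
      by (intro summable_LIMSEQ summable_krank_term) simp
    hence "\<forall>\<^sub>F N in sequentially. fps_nth (\<Sum>j<N. ?f j) n = fps_nth (suminf ?f) n"
      unfolding tendsto_fps_iff by blast
    then obtain N0 where N0: "\<forall>N\<ge>N0. fps_nth (\<Sum>j<N. ?f j) n = fps_nth (suminf ?f) n"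
      unfolding eventually_sequentially by blast
    have "fps_nth (suminf ?f) n = (\<Sum>j<max N0 J. fps_nth (?f j) n)"
      using N0 by (metis fps_sum_nth max.cobounded1)
    also have "\<dots> = (\<Sum>j<J. fps_nth (?f j) n)"
      using n by (intro sum.mono_neutral_right) (auto simp: krank_term_nth_eq_0)
    finally show "fps_nth (suminf ?f - (\<Sum>j<J. ?f j)) n = 0"
      by (simp add: fps_sum_nth)
  qed
  hence "q ^ J dvd ipoch_inf * (suminf ?f - (\<Sum>j<J. ?f j))" by (rule dvd_mult)
  moreover have "(\<Sum>r\<in>{1..J}. q ^ (i * (r * r)) * bailey_alpha r m) = (\<Sum>j<J. ?f j)"
    unfolding One_nat_def sum.atLeast1_atMost_eq
    by (intro sum.cong refl krank_term_bailey_alpha[symmetric]) simp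
  ultimately show ?thesis
    by (simp add: krank_gf_def ipoch_inf_def right_diff_distrib)
qed

lemma sum_triangle_swap:
  fixes f :: "nat \<Rightarrow> nat \<Rightarrow> 'a::comm_monoid_add"
  shows "(\<Sum>j\<in>{1..N}. \<Sum>r\<in>{1..j}. f j r) = (\<Sum>r\<in>{1..N}. \<Sum>t\<le>N - r. f (r + t) r)"
proof -
  have "(\<Sum>j\<in>{1..N}. \<Sum>r\<in>{1..j}. f j r) = (\<Sum>j\<in>{1..N}. \<Sum>r\<in>{r\<in>{1..N}. r \<le> j}. f j r)"
    by (intro sum.cong) auto
  also have "\<dots> = (\<Sum>r\<in>{1..N}. \<Sum>j\<in>{j\<in>{1..N}. r \<le> j}. f j r)"
    by (rule sum.swap_restrict) auto
  also have "\<dots> = (\<Sum>r\<in>{1..N}. \<Sum>t\<le>N - r. f (r + t) r)"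
  proof (rule sum.cong[OF refl])
    fix r assume "r \<in> {1..N}"
    thus "(\<Sum>j\<in>{j\<in>{1..N}. r \<le> j}. f j r) = (\<Sum>t\<le>N - r. f (r + t) r)"
      by (intro sum.reindex_bij_witness[where i = "\<lambda>t. r + t" and j = "\<lambda>j. j - r"]) auto
  qed
  finally show ?thesis .
qed

text \<open>One step of the Bailey chain: after interchanging the two summations the inner sum is
  the finite Durfee identity with \<open>L = N - r\<close> and \<open>a = 2 * r\<close>.\<close>

lemma bailey_beta_Suc: "bailey_beta (Suc i) N m = (\<Sum>j\<in>{1..N}. q ^ (j * j) * ipoch (N - j) * bailey_beta i j m)"
proof -
  let ?c = "\<lambda>r. q ^ (i * (r * r)) * bailey_alpha r m"
  have "(\<Sum>j\<in>{1..N}. q ^ (j * j) * ipoch (N - j) * bailey_beta i j m) =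
      (\<Sum>j\<in>{1..N}. \<Sum>r\<in>{1..j}. q ^ (j * j) * ipoch (N - j) * (?c r * ipoch (j - r) * ipoch (j + r)))"
    by (simp only: bailey_beta_def sum_distrib_left)
  also have "\<dots> = (\<Sum>r\<in>{1..N}. \<Sum>t\<le>N - r.
      q ^ ((r + t) * (r + t)) * ipoch (N - (r + t)) * (?c r * ipoch (r + t - r) * ipoch (r + t + r)))"
    by (rule sum_triangle_swap)
  also have "\<dots> = (\<Sum>r\<in>{1..N}. q ^ (Suc i * (r * r)) * bailey_alpha r m * ipoch (N - r) * ipoch (N + r))"
  proof (rule sum.cong[OF refl])
    fix r assume r: "r \<in> {1..N}"
    have "(\<Sum>t\<le>N - r. q ^ ((r + t) * (r + t)) * ipoch (N - (r + t)) * (?c r * ipoch (r + t - r) * ipoch (r + t + r)))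
        = (\<Sum>t\<le>N - r. q ^ (r * r) * ?c r *
            (q ^ (t * (t + 2 * r)) * ipoch (N - r - t) * ipoch t * ipoch (t + 2 * r)))"
    proof (rule sum.cong[OF refl])
      fix t
      have e: "(r + t) * (r + t) = r * r + t * (t + 2 * r)" "r + t + r = t + 2 * r" "r + t - r = t"
        by (simp_all add: algebra_simps)
      show "q ^ ((r + t) * (r + t)) * ipoch (N - (r + t)) * (?c r * ipoch (r + t - r) * ipoch (r + t + r)) =
          q ^ (r * r) * ?c r * (q ^ (t * (t + 2 * r)) * ipoch (N - r - t) * ipoch t * ipoch (t + 2 * r))"
        unfolding e power_add diff_diff_left by (simp only: mult_ac)
    qed
    also have "\<dots> = q ^ (r * r) * ?c r * (ipoch (N - r) * ipoch (N - r + 2 * r))"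
      unfolding sum_distrib_left[symmetric] durfee_finite ..
    also have "N - r + 2 * r = N + r" using r by auto
    also have "q ^ (r * r) * ?c r * (ipoch (N - r) * ipoch (N + r)) =
        q ^ (Suc i * (r * r)) * bailey_alpha r m * ipoch (N - r) * ipoch (N + r)"
      unfolding mult_Suc power_add by (simp only: mult_ac)
    finally show "(\<Sum>t\<le>N - r. q ^ ((r + t) * (r + t)) * ipoch (N - (r + t)) *
        (?c r * ipoch (r + t - r) * ipoch (r + t + r))) =
        q ^ (Suc i * (r * r)) * bailey_alpha r m * ipoch (N - r) * ipoch (N + r)" .
  qed
  finally show ?thesis by (simp only: bailey_beta_def)
qed

text \<open>The last step of the chain, with \<open>N\<close> infinite. Unfolding the inner \<open>\<beta>\<close> through the
  chain gives the classical multiple sum over successive Durfee squares.\<close>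

lemma krank_gf_bailey_chain:
  "q ^ J dvd krank_gf (int (Suc (Suc i))) (int m) - (\<Sum>j\<in>{1..J}. q ^ (j * j) * bailey_beta i j m)"
proof -
  let ?c = "\<lambda>r. q ^ (i * (r * r)) * bailey_alpha r m"
  have "(\<Sum>j\<in>{1..J}. q ^ (j * j) * bailey_beta i j m) =
      (\<Sum>j\<in>{1..J}. \<Sum>r\<in>{1..j}. q ^ (j * j) * (?c r * ipoch (j - r) * ipoch (j + r)))"
    by (simp only: bailey_beta_def sum_distrib_left)
  also have "\<dots> = (\<Sum>r\<in>{1..J}. \<Sum>t\<le>J - r.
      q ^ ((r + t) * (r + t)) * (?c r * ipoch (r + t - r) * ipoch (r + t + r)))"
    by (rule sum_triangle_swap)
  also have "\<dots> = (\<Sum>r\<in>{1..J}. ?c r * q ^ (r * r) *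
      (\<Sum>t\<le>J - r. q ^ (t * (t + 2 * r)) * ipoch t * ipoch (t + 2 * r)))"
    unfolding sum_distrib_left
  proof (intro sum.cong[OF refl])
    fix r t :: nat
    have e: "(r + t) * (r + t) = r * r + t * (t + 2 * r)" "r + t + r = t + 2 * r" "r + t - r = t"
      by (simp_all add: algebra_simps)
    show "q ^ ((r + t) * (r + t)) * (?c r * ipoch (r + t - r) * ipoch (r + t + r)) =
        ?c r * q ^ (r * r) * (q ^ (t * (t + 2 * r)) * ipoch t * ipoch (t + 2 * r))"
      unfolding e power_add by (simp only: mult_ac)
  qed
  finally have eq: "(\<Sum>j\<in>{1..J}. q ^ (j * j) * bailey_beta i j m) = \<dots>" .
  have "q ^ J dvd (\<Sum>r\<in>{1..J}. ?c r * q ^ (r * r) * ipoch_inf) - (\<Sum>j\<in>{1..J}. q ^ (j * j) * bailey_beta i j m)"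
    unfolding eq
  proof (rule X_cong_sum)
    fix r assume r: "r \<in> {1..J}"
    let ?S = "\<Sum>t\<le>J - r. q ^ (t * (t + 2 * r)) * ipoch t * ipoch (t + 2 * r)"
    have "q ^ (r * r) * q ^ (J - r) dvd ?c r * q ^ (r * r) * (ipoch_inf - ?S)"
      by (intro mult_dvd_mono dvd_triv_right X_cong_sym[OF durfee_limit])
    moreover have "r \<le> r * r" using r by simp
    hence "J \<le> r * r + (J - r)" by linarith
    hence "q ^ J dvd q ^ (r * r) * q ^ (J - r)"
      unfolding power_add[symmetric] by (rule le_imp_power_dvd)
    ultimately show "q ^ J dvd ?c r * q ^ (r * r) * ipoch_inf - ?c r * q ^ (r * r) * ?S"
      unfolding right_diff_distrib using dvd_trans by blast
  qed
  moreover have "ipoch_inf * (\<Sum>r\<in>{1..J}. q ^ (Suc i * (r * r)) * bailey_alpha r m) =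
      (\<Sum>r\<in>{1..J}. ?c r * q ^ (r * r) * ipoch_inf)"
    unfolding sum_distrib_left mult_Suc power_add
    by (intro sum.cong refl) (simp only: mult_ac)
  ultimately show ?thesis
    using X_cong_trans[OF krank_gf_cong[of J "Suc i" m]] by simp
qed

section \<open>Three-term recurrences for the Bailey sequence\<close>

lemma bailey_alpha_Suc: "bailey_alpha r (Suc m) = q ^ r * bailey_alpha r m"
  unfolding bailey_alpha_def mult_Suc power_add by (simp only: mult_ac)

text \<open>The recurrences in \<open>N\<close> hold term by term because
  \<open>(1 - q ^ (N + 1 - r)) * (1 - q ^ (N + 1 + r)) = 1 + Q\<^sup>2 - Q * (q ^ r + q ^ (-r))\<close> for
  \<open>Q = q ^ (N + 1)\<close>, and shifting \<open>m\<close> by one multiplies \<open>\<alpha>_r\<close> by \<open>q ^ r\<close>.\<close>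

lemma ipoch_pair_down:
  assumes "r \<le> N"
  shows "ipoch (N - r) * ipoch (N + r) =
    (1 - q ^ (Suc N - r)) * (1 - q ^ (Suc N + r)) * ipoch (Suc N - r) * ipoch (Suc N + r)"
proof -
  have "Suc N - r = Suc (N - r)" using assms by simp
  thus ?thesis unfolding ipoch_eq[of "N - r"] ipoch_eq[of "N + r"] by (simp only: mult_ac add_Suc)
qed

lemma bailey_beta_as_Suc_terms:
  "bailey_beta 0 N m = (\<Sum>r\<in>{1..Suc N}. bailey_alpha r m *
    (1 - q ^ (Suc N - r)) * (1 - q ^ (Suc N + r)) * ipoch (Suc N - r) * ipoch (Suc N + r))"
proof -
  have "bailey_beta 0 N m = (\<Sum>r\<in>{1..N}. bailey_alpha r m *
    (1 - q ^ (Suc N - r)) * (1 - q ^ (Suc N + r)) * ipoch (Suc N - r) * ipoch (Suc N + r))"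
    unfolding bailey_beta_def mult_0 power_0 mult_1
  proof (rule sum.cong[OF refl])
    fix r assume "r \<in> {1..N}"
    hence "r \<le> N" by simp
    thus "bailey_alpha r m * ipoch (N - r) * ipoch (N + r) = bailey_alpha r m *
        (1 - q ^ (Suc N - r)) * (1 - q ^ (Suc N + r)) * ipoch (Suc N - r) * ipoch (Suc N + r)"
      by (simp only: mult.assoc ipoch_pair_down[of r N, unfolded mult.assoc])
  qed
  thus ?thesis by simp
qed

text \<open>This says that multiplying the generating function in \<open>z\<close> of the \<open>\<beta>\<close> for \<open>N + 1\<close> by
  \<open>(1 - z * Q) * (1 - Q / z)\<close> gives that for \<open>N\<close>.\<close>

lemma bailey_beta_three_term:
  fixes N m :: nat
  defines "Q \<equiv> q ^ Suc N"
  shows "(1 + Q * Q) * bailey_beta 0 (Suc N) (Suc m)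
      - Q * (bailey_beta 0 (Suc N) m + bailey_beta 0 (Suc N) (Suc (Suc m))) = bailey_beta 0 N (Suc m)"
proof -
  have aux: "(1 + x * y * (x * y)) * (x * a * u * v) - x * y * (a * u * v + x * (x * a) * u * v)
      = x * a * (1 - y) * (1 - x * y * x) * u * v" for x y a u v :: "int fps"
    by (simp add: algebra_simps)
  have "(1 + Q * Q) * bailey_beta 0 (Suc N) (Suc m)
      - Q * (bailey_beta 0 (Suc N) m + bailey_beta 0 (Suc N) (Suc (Suc m))) =
    (\<Sum>r\<in>{1..Suc N}. (1 + Q * Q) * (bailey_alpha r (Suc m) * ipoch (Suc N - r) * ipoch (Suc N + r))
      - Q * (bailey_alpha r m * ipoch (Suc N - r) * ipoch (Suc N + r)
           + bailey_alpha r (Suc (Suc m)) * ipoch (Suc N - r) * ipoch (Suc N + r)))"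
    unfolding bailey_beta_def mult_0 power_0 mult_1 sum_distrib_left sum.distrib[symmetric]
      sum_subtractf[symmetric] ..
  also have "\<dots> = bailey_beta 0 N (Suc m)"
    unfolding bailey_beta_as_Suc_terms[of N]
  proof (rule sum.cong[OF refl])
    fix r assume r: "r \<in> {1..Suc N}"
    define x y where "x = q ^ r" and "y = q ^ (Suc N - r)"
    have Q: "Q = x * y" using r by (simp add: Q_def x_def y_def power_add[symmetric] del: power_Suc)
    have Q': "q ^ (Suc N + r) = x * y * x"
      unfolding Q[symmetric] by (simp only: power_add x_def Q_def)
    show "(1 + Q * Q) * (bailey_alpha r (Suc m) * ipoch (Suc N - r) * ipoch (Suc N + r))
      - Q * (bailey_alpha r m * ipoch (Suc N - r) * ipoch (Suc N + r)
           + bailey_alpha r (Suc (Suc m)) * ipoch (Suc N - r) * ipoch (Suc N + r)) =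
      bailey_alpha r (Suc m) * (1 - q ^ (Suc N - r)) * (1 - q ^ (Suc N + r)) * ipoch (Suc N - r) * ipoch (Suc N + r)"
      unfolding Q' bailey_alpha_Suc x_def[symmetric] y_def[symmetric] Q by (rule aux)
  qed
  finally show ?thesis .
qed

lemma triangular_Suc: "Suc R * R div 2 = R * (R - 1) div 2 + R"
proof -
  have "Suc R * R = R * (R - 1) + R * 2" by (cases R) auto
  thus ?thesis by simp
qed

text \<open>The recurrence at \<open>m = 0\<close> involves \<open>m - 1 = -1\<close>, where the symmetry \<open>z \<leftrightarrow> 1/z\<close> is not
  visible in the \<open>\<alpha>_r\<close>. The discrepancy is the sum below. It is summable in closed form
  after multiplication by \<open>1 - q ^ (M - 1)\<close>, as in Gosper's algorithm, and the closed form
  vanishes at \<open>R = M\<close>.\<close>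

lemma defect_partial_sum:
  assumes "M \<ge> 1" "R \<le> M"
  shows "(1 - q ^ (M - 1)) *
      (\<Sum>r\<in>{1..R}. bailey_alpha r 0 * q ^ (M - r) * (1 - q ^ (2 * r)) * ipoch (M - r) * ipoch (M + r)) =
    - ((-1) ^ R) * q ^ (R * (R - 1) div 2) * q ^ (M - 1) * (1 - q ^ R) * (1 - q ^ Suc R)
      * (1 - q ^ (M - R)) * ipoch (M - R) * ipoch (M + R)"
  using assms(2)
proof (induction R)
  case (Suc R)
  define d where "d = M - Suc R"
  define x y s E I J where "x = q ^ R" and "y = q ^ d" and "s = ((-1) ^ R :: int fps)"
    and "E = q ^ (R * (R - 1) div 2)" and "I = ipoch d" and "J = ipoch (M + Suc R)"
  have M: "M = Suc (d + R)" using Suc.prems by (simp add: d_def)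
  have M1: "q ^ (M - 1) = x * y" by (simp add: M x_def y_def power_add mult_ac)
  have IH: "(1 - q ^ (M - 1)) *
      (\<Sum>r\<in>{1..R}. bailey_alpha r 0 * q ^ (M - r) * (1 - q ^ (2 * r)) * ipoch (M - r) * ipoch (M + r)) =
      - s * E * (x * y) * (1 - x) * (1 - x * q) * I * ((1 - x * x * y * q * q) * J)"
  proof -
    have 1: "(1 - q ^ (M - R)) * ipoch (M - R) = I"
      using ipoch_eq[of d] by (simp add: M I_def del: power_Suc)
    have 2: "ipoch (M + R) = (1 - x * x * y * q * q) * J"
      unfolding J_def add_Suc_right ipoch_eq[of "M + R"] by (simp add: M x_def y_def power_add mult_ac)
    have "R \<le> M" using Suc.prems by simp
    note Suc.IH[OF this]
    also have "- ((-1) ^ R) * q ^ (R * (R - 1) div 2) * q ^ (M - 1) * (1 - q ^ R) * (1 - q ^ Suc R)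
      * (1 - q ^ (M - R)) * ipoch (M - R) * ipoch (M + R) =
      - s * E * (x * y) * (1 - x) * (1 - x * q) * ((1 - q ^ (M - R)) * ipoch (M - R)) * ipoch (M + R)"
      unfolding M1 by (simp only: E_def s_def x_def power_Suc2 mult.assoc)
    finally show ?thesis unfolding 1 2 .
  qed
  have a: "bailey_alpha (Suc R) 0 = s * (E * x) * (1 - x * q)"
  proof -
    have "Suc R * R div 2 = R * (R - 1) div 2 + R" by (rule triangular_Suc)
    thus ?thesis by (simp add: bailey_alpha_def s_def E_def x_def power_add mult_ac)
  qed
  have E: "q ^ (Suc R * (Suc R - 1) div 2) = E * x"
  proof -
    have "Suc R * R div 2 = R * (R - 1) div 2 + R" by (rule triangular_Suc)
    thus ?thesis by (simp add: E_def x_def power_add)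
  qed
  have t: "q ^ (2 * Suc R) = x * q * (x * q)" "q ^ Suc R = x * q" "q ^ Suc (Suc R) = x * q * q"
    by (simp_all only: x_def mult_2 power_add power_Suc2 mult.assoc)
  have aux: "- s * E * (x * y) * (1 - x) * (1 - x * z) * I * ((1 - x * x * y * z * z) * J)
      + (1 - x * y) * (s * (E * x) * (1 - x * z) * y * (1 - x * z * (x * z)) * I * J) =
      - (- s) * (E * x) * (x * y) * (1 - x * z) * (1 - x * z * z) * (1 - y) * I * J"
    for s E x y z I J :: "int fps"
    by (simp add: algebra_simps)
  have "(1 - q ^ (M - 1)) *
      (\<Sum>r\<in>{1..Suc R}. bailey_alpha r 0 * q ^ (M - r) * (1 - q ^ (2 * r)) * ipoch (M - r) * ipoch (M + r)) =
    - s * E * (x * y) * (1 - x) * (1 - x * q) * I * ((1 - x * x * y * q * q) * J)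
      + (1 - x * y) * (s * (E * x) * (1 - x * q) * y * (1 - x * q * (x * q)) * I * J)"
  proof -
    have "bailey_alpha (Suc R) 0 * q ^ (M - Suc R) * (1 - q ^ (2 * Suc R)) * ipoch (M - Suc R) * ipoch (M + Suc R)
        = s * (E * x) * (1 - x * q) * y * (1 - x * q * (x * q)) * I * J"
      unfolding a t(1) y_def I_def J_def d_def ..
    moreover have "(\<Sum>r\<in>{1..Suc R}. f r) = (\<Sum>r\<in>{1..R}. f r) + f (Suc R)" for f :: "nat \<Rightarrow> int fps"
      by simp
    ultimately show ?thesis
      unfolding IH[symmetric] by (simp only: distrib_left M1)
  qed
  also have "\<dots> = - (- s) * (E * x) * (x * y) * (1 - x * q) * (1 - x * q * q) * (1 - y) * I * J"
    by (rule aux)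
  finally show ?case
    unfolding E M1 t by (simp only: s_def y_def I_def J_def d_def power_Suc mult_minus1 minus_minus)
qed simp

text \<open>The restriction \<open>M \<ge> 2\<close> is essential: for \<open>M = 1\<close> the factor \<open>1 - q ^ (M - 1)\<close> of the
  telescoped identity is zero, and the sum is not.\<close>

lemma defect_sum_0:
  assumes "M \<ge> 2"
  shows "(\<Sum>r\<in>{1..M}. bailey_alpha r 0 * q ^ (M - r) * (1 - q ^ (2 * r)) * ipoch (M - r) * ipoch (M + r)) = 0"
  using defect_partial_sum[of M M] one_minus_X_power_nonzero[of "M - 1"] assms by simp

lemma bailey_beta_three_term_0:
  fixes N :: nat
  defines "Q \<equiv> q ^ Suc N"
  assumes "N \<ge> 1"
  shows "(1 + Q * Q) * bailey_beta 0 (Suc N) 0 - 2 * Q * bailey_beta 0 (Suc N) 1 = bailey_beta 0 N 0"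
proof -
  have aux: "(1 + x * y * (x * y)) * (a * u * v) - 2 * (x * y) * (x * a * u * v) =
      a * (1 - y) * (1 - x * y * x) * u * v + a * y * (1 - x * x) * u * v"
    for x y a u v :: "int fps"
    by (simp add: algebra_simps)
  have "(1 + Q * Q) * bailey_beta 0 (Suc N) 0 - 2 * Q * bailey_beta 0 (Suc N) 1 =
    (\<Sum>r\<in>{1..Suc N}. (1 + Q * Q) * (bailey_alpha r 0 * ipoch (Suc N - r) * ipoch (Suc N + r))
      - 2 * Q * (bailey_alpha r 1 * ipoch (Suc N - r) * ipoch (Suc N + r)))"
    unfolding bailey_beta_def mult_0 power_0 mult_1 sum_distrib_left sum_subtractf[symmetric] ..
  also have "\<dots> = (\<Sum>r\<in>{1..Suc N}. bailey_alpha r 0 *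
      (1 - q ^ (Suc N - r)) * (1 - q ^ (Suc N + r)) * ipoch (Suc N - r) * ipoch (Suc N + r)
      + bailey_alpha r 0 * q ^ (Suc N - r) * (1 - q ^ (2 * r)) * ipoch (Suc N - r) * ipoch (Suc N + r))"
  proof (rule sum.cong[OF refl])
    fix r assume r: "r \<in> {1..Suc N}"
    define x y where "x = q ^ r" and "y = q ^ (Suc N - r)"
    have Q: "Q = x * y" using r by (simp add: Q_def x_def y_def power_add[symmetric] del: power_Suc)
    have Q': "q ^ (Suc N + r) = x * y * x"
      unfolding Q[symmetric] by (simp only: power_add x_def Q_def)
    have x2: "q ^ (2 * r) = x * x" by (simp only: mult_2 power_add x_def)
    show "(1 + Q * Q) * (bailey_alpha r 0 * ipoch (Suc N - r) * ipoch (Suc N + r))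
      - 2 * Q * (bailey_alpha r 1 * ipoch (Suc N - r) * ipoch (Suc N + r)) =
      bailey_alpha r 0 * (1 - q ^ (Suc N - r)) * (1 - q ^ (Suc N + r)) * ipoch (Suc N - r) * ipoch (Suc N + r)
      + bailey_alpha r 0 * q ^ (Suc N - r) * (1 - q ^ (2 * r)) * ipoch (Suc N - r) * ipoch (Suc N + r)"
      unfolding Q' x2 One_nat_def bailey_alpha_Suc x_def[symmetric] y_def[symmetric] Q by (rule aux)
  qed
  also have "\<dots> = bailey_beta 0 N 0"
    unfolding sum.distrib bailey_beta_as_Suc_terms[of N 0]
    using defect_sum_0[of "Suc N"] assms(2) by simp
  finally show ?thesis .
qed

section \<open>Positivity of the differences of the Bailey sequence\<close>

text \<open>The functional equation determines the coefficients of all \<open>f i\<close> recursively from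
  those of the \<open>a i\<close>, because \<open>M > 0\<close>.\<close>

lemma fps_nonneg_fixpoint:
  assumes "M > 0" and rec: "\<And>i. f i = a i + q ^ M * f (Suc i)" and "\<And>i. fps_nonneg (a i)"
  shows "fps_nonneg (f i)"
proof -
  have "\<forall>i. 0 \<le> fps_nth (f i) n" for n
  proof (induction n rule: less_induct)
    case (less n)
    show ?case
    proof
      fix i
      have "fps_nth (f i) n = fps_nth (a i) n + (if n < M then 0 else fps_nth (f (Suc i)) (n - M))"
        by (subst rec) (simp add: fps_X_power_mult_nth)
      moreover have "0 \<le> fps_nth (f (Suc i)) (n - M)" if "\<not> n < M"
        using less[of "n - M"] that assms(1) by auto
      ultimately show "0 \<le> fps_nth (f i) n"
        using fps_nonnegD[OF assms(3)[of i], of n] by auto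
    qed
  qed
  thus ?thesis by (simp add: fps_nonneg_def)
qed

text \<open>The operator on the left factors: with the forward and backward combinations
  \<open>U m = B m - Q * B (m + 1)\<close> and \<open>V m = B (m + 1) - Q * B m\<close> the recurrence becomes
  \<open>U (m + 1) = A (m + 1) + Q * U m\<close> and \<open>V m = A (m + 1) + Q * V (m + 1)\<close>, both of which
  preserve nonnegativity. The series \<open>e\<close> measures how far \<open>A 0\<close> is from being nonnegative;
  \<open>A 1\<close> has to absorb \<open>Q * e\<close>.\<close>

lemma three_term_positivity:
  fixes A B :: "nat \<Rightarrow> int fps" and e :: "int fps"
  assumes "M > 0" and Q: "Q = q ^ M"
    and rec: "\<And>m. (1 + Q * Q) * B (Suc m) - Q * (B m + B (Suc (Suc m))) = A (Suc m)"
    and rec0: "(1 + Q * Q) * B 0 - 2 * Q * B 1 = A 0"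
    and pos: "\<And>m. fps_nonneg (A (Suc m))" and pos0: "fps_nonneg (A 0 + e)"
    and pos1: "fps_nonneg (A 1 - Q * e)"
  shows "fps_nonneg (B 0 + e)" and "fps_nonneg (B (Suc m))"
    and "fps_nonneg (B 2 - A 2)" and "fps_nonneg (B 1 - Q * B 2)"
proof -
  define U V where "U m = B m - Q * B (Suc m)" and "V m = B (Suc m) - Q * B m" for m
  have Qpos: "fps_nonneg Q" unfolding Q by (intro fps_nonneg_intros)
  have V: "fps_nonneg (V i)" for i
  proof (rule fps_nonneg_fixpoint[OF \<open>M > 0\<close>, of V "\<lambda>i. A (Suc i)"])
    show "V i = A (Suc i) + q ^ M * V (Suc i)" for i
      unfolding V_def Q[symmetric] rec[symmetric] by (simp add: algebra_simps)
  qed (rule pos)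
  have U0: "fps_nonneg (U 0 + e)"
  proof -
    have "U 0 + e = (A 0 + e) + Q * V 0"
      unfolding U_def V_def rec0[symmetric] by (simp add: algebra_simps)
    also have "fps_nonneg \<dots>" by (intro fps_nonneg_add fps_nonneg_mult pos0 Qpos V)
    finally show ?thesis .
  qed
  have U_Suc: "U (Suc m) = A (Suc m) + Q * U m" for m
    unfolding U_def rec[symmetric] by (simp add: algebra_simps)
  have U: "fps_nonneg (U (Suc m))" for m
  proof (induction m)
    case 0
    have "U 1 = (A 1 - Q * e) + Q * (U 0 + e)"
      using U_Suc[of 0] by (simp add: algebra_simps)
    thus ?case using pos1 U0 Qpos by (simp add: fps_nonneg_add fps_nonneg_mult)
  next
    case (Suc m)
    thus ?case using U_Suc[of "Suc m"] pos[of "Suc m"] Qpos by (simp add: fps_nonneg_add fps_nonneg_mult)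
  qed
  have B_Suc: "fps_nonneg (B (Suc m))" for m
    by (rule fps_nonneg_fixpoint[OF \<open>M > 0\<close>, of "\<lambda>m. B (Suc m)" "\<lambda>m. U (Suc m)"])
       (auto simp: U_def Q U[unfolded U_def Q])
  show "fps_nonneg (B (Suc m))" by (rule B_Suc)
  have "B 0 + e = (U 0 + e) + Q * B 1" by (simp add: U_def)
  also have "fps_nonneg \<dots>"
    by (rule fps_nonneg_add[OF U0 fps_nonneg_mult[OF Qpos B_Suc[of 0, folded One_nat_def]]])
  finally show "fps_nonneg (B 0 + e)" .
  have "B 2 - A 2 = Q * U 1 + Q * B 3"
    using U_Suc[of 1] by (simp add: U_def numeral_eq_Suc algebra_simps)
  thus "fps_nonneg (B 2 - A 2)"
    using Qpos U[of 0] B_Suc[of 2] by (simp add: fps_nonneg_add fps_nonneg_mult numeral_eq_Suc)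
  have "B 1 - Q * B 2 = U 1" by (simp add: U_def numeral_eq_Suc)
  thus "fps_nonneg (B 1 - Q * B 2)" using U[of 0] by simp
qed

definition beta_diff :: "nat \<Rightarrow> nat \<Rightarrow> nat \<Rightarrow> int fps" where
  "beta_diff i N m = (1 - q) * bailey_beta i N m"

text \<open>This is \<open>1 / ((1 - q\<^sup>2) \<dots> (1 - q ^ n))\<close> for \<open>n \<ge> 1\<close>: the factor \<open>1 - q\<close> that comes
  from taking differences removes the parts of size one, which is why differences can be
  nonnegative at all.\<close>

definition ipoch2 :: "nat \<Rightarrow> int fps" where "ipoch2 n = (1 - q) * ipoch n"

lemma ipoch2_0: "ipoch2 0 = 1 - q" by (simp add: ipoch2_def)

lemma ipoch2_1: "ipoch2 (Suc 0) = 1"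
  using geo_inverse[of 1] by (simp add: ipoch2_def ipoch_Suc)

lemma ipoch2_Suc: "ipoch2 (Suc n) = ipoch2 n * geo (Suc n)"
  by (simp add: ipoch2_def ipoch_Suc mult_ac)

lemma fps_nonneg_ipoch2: "fps_nonneg (ipoch2 (Suc n))"
  by (induction n) (auto simp: ipoch2_1 ipoch2_Suc[of "Suc _"] intro: fps_nonneg_intros)

lemma bailey_alpha_1: "bailey_alpha 1 m = q ^ m * (1 - q)"
  by (simp add: bailey_alpha_def)

lemma geo_1: "(1 - q) * geo 1 = 1"
  using geo_inverse[of 1] by (simp only: power_one_right zero_less_one)

lemma bailey_beta_1: "bailey_beta i 1 m = q ^ (i + m) * geo 2"
proof -
  have ip2: "ipoch 2 = geo 1 * geo 2" by (simp add: numeral_2_eq_2 ipoch_Suc)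
  have "bailey_beta i 1 m = q ^ i * bailey_alpha 1 m * ipoch 0 * ipoch 2"
    by (simp add: bailey_beta_def numeral_2_eq_2)
  also have "\<dots> = q ^ i * q ^ m * ((1 - q) * geo 1) * geo 2"
    unfolding ipoch_0 ip2 bailey_alpha_1 by (simp only: mult_ac mult_1)
  finally show ?thesis unfolding geo_1 power_add mult_1_right .
qed

text \<open>Here the recurrence is applied with \<open>e = 0\<close>, starting from \<open>q ^ m / (1 - q\<^sup>2)\<close> at
  \<open>N = 1\<close>.\<close>

lemma fps_nonneg_bailey_beta_0: "fps_nonneg (bailey_beta 0 (Suc N) m)"
proof (induction N arbitrary: m)
  case 0
  thus ?case unfolding One_nat_def[symmetric] bailey_beta_1 by (intro fps_nonneg_intros)
next
  case (Suc N)
  have 1: "fps_nonneg (bailey_beta 0 (Suc N) 0 + 0)" "fps_nonneg (bailey_beta 0 (Suc N) 1 - q ^ Suc (Suc N) * 0)"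
    unfolding mult_zero_right diff_zero add_0_right by (rule Suc.IH)+
  have "1 \<le> Suc N" by simp
  note * = three_term_positivity[where M = "Suc (Suc N)" and e = 0,
      OF zero_less_Suc refl bailey_beta_three_term bailey_beta_three_term_0 Suc.IH 1, OF this]
  show ?case using *(1,2) by (cases m) auto
qed

lemma fps_nonneg_bailey_beta: "N \<ge> 1 \<Longrightarrow> fps_nonneg (bailey_beta i N m)"
proof (induction i arbitrary: N)
  case 0
  then obtain N' where "N = Suc N'" by (cases N) auto
  thus ?case by (simp only: fps_nonneg_bailey_beta_0)
next
  case (Suc i)
  show ?case
    unfolding bailey_beta_Suc
  proof (rule fps_nonneg_sum)
    fix j assume "j \<in> {1..N}"
    hence "fps_nonneg (bailey_beta i j m)" by (intro Suc.IH) simp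
    thus "fps_nonneg (q ^ (j * j) * ipoch (N - j) * bailey_beta i j m)"
      by (rule fps_nonneg_mult[OF fps_nonneg_mult[OF fps_nonneg_power[OF fps_nonneg_X] fps_nonneg_ipoch]])
  qed
qed
lemma bailey_alpha_2: "bailey_alpha 2 m = - (q * q ^ m * q ^ m * (1 - q ^ 2))"
proof -
  have "2 * (2 - 1) div 2 + m * 2 = 1 + m + m" by simp
  thus ?thesis unfolding bailey_alpha_def by (simp only: power_add power_one_right) simp
qed

lemma beta_diff_2:
  "beta_diff 0 2 m = q ^ m * ((1 + q ^ 2 - q ^ (m + 1)) * geo 3 * geo 4)"
proof -
  define x where "x = q ^ m"
  have g: "(1 - q) * geo 1 = 1" "(1 - q ^ 2) * geo 2 = 1" "(1 - q ^ 4) * geo 4 = 1"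
    using geo_inverse[of 1] by (simp_all only: geo_inverse power_one_right zero_less_one)
  have ipoch: "ipoch 1 = geo 1" "ipoch 3 = geo 1 * geo 2 * geo 3" "ipoch 4 = geo 1 * geo 2 * geo 3 * geo 4"
    by (simp_all add: numeral_eq_Suc ipoch_Suc mult_ac)
  have "{1..2} = {1, 2::nat}" by auto
  hence b: "bailey_beta 0 2 m = bailey_alpha 1 m * ipoch 1 * ipoch 3 + bailey_alpha 2 m * ipoch 0 * ipoch 4"
    unfolding bailey_beta_def by (simp add: numeral_eq_Suc)
  have a: "bailey_alpha 1 m = x * (1 - q)" "bailey_alpha 2 m = - (q * x * x * (1 - q ^ 2))"
    unfolding bailey_alpha_1 bailey_alpha_2 x_def by (rule refl)+
  have "geo 2 = (1 + q ^ 2) * geo 4" using g(2,3) by algebra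
  have aux: "(1 - p) * (x * (1 - p) * a * (a * b * c) + - (p * x * x * (1 - r)) * (a * b * c * d))
      = x * ((1 - p) * a) * ((1 - p) * a) * b * c - p * x * x * ((1 - p) * a) * ((1 - r) * b) * c * d"
    for p r a b c d :: "int fps"
    by (simp add: algebra_simps)
  have "beta_diff 0 2 m = x * geo 2 * geo 3 - q * x * x * geo 3 * geo 4"
    unfolding beta_diff_def b a ipoch ipoch_0 aux g mult_1_right ..
  also have "\<dots> = x * ((1 + q ^ 2 - x * q) * geo 3 * geo 4)"
    unfolding \<open>geo 2 = _\<close> by (simp add: algebra_simps)
  finally show ?thesis unfolding power_add power_one_right x_def .
qed

text \<open>Since \<open>1 + q\<^sup>2 - q ^ s = (1 + q\<^sup>2) * (1 - q\<^sup>3) + q\<^sup>3 * (1 + q\<^sup>2 - q ^ (s - 3))\<close>, the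
  claim for \<open>s\<close> follows from that for \<open>s - 3\<close>; three consecutive values are checked by
  hand. For \<open>s = 1\<close> it is false: the coefficient of \<open>q\<close> is then \<open>-1\<close>.\<close>

lemma core_positivity:
  assumes "s \<ge> 2"
  shows "fps_nonneg ((1 + q ^ 2 - q ^ s) * geo 3 * geo 4)"
  using assms
proof (induction s rule: less_induct)
  case (less s)
  have g: "(1 - q ^ 3) * geo 3 = 1" "(1 - q ^ 4) * geo 4 = 1" by (simp_all only: geo_inverse)
  consider "s = 2" | "s = 3" | "s = 4" | "s \<ge> 5" using less.prems by linarith
  thus ?case
  proof cases
    case 1
    thus ?thesis by (simp add: fps_nonneg_intros)
  next
    case 2
    have "(1 + q ^ 2 - q ^ 3) * geo 3 * geo 4 = geo 4 + q ^ 2 * geo 3 * geo 4"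
      using g by algebra
    thus ?thesis unfolding 2 by (simp only: fps_nonneg_intros)
  next
    case 3
    have "(1 + q ^ 2 - q ^ 4) * geo 3 * geo 4 = geo 3 + q ^ 2 * geo 3 * geo 4"
      using g by algebra
    thus ?thesis unfolding 3 by (simp only: fps_nonneg_intros)
  next
    case 4
    have "q ^ s = q ^ 3 * q ^ (s - 3)" using 4 by (simp only: power_add[symmetric]) simp
    moreover have "(1 + q ^ 2 - q ^ 3 * y) * geo 3 * geo 4 =
        (1 + q ^ 2) * geo 4 + q ^ 3 * ((1 + q ^ 2 - y) * geo 3 * geo 4)" for y
      using g by algebra
    ultimately have "(1 + q ^ 2 - q ^ s) * geo 3 * geo 4 =
        (1 + q ^ 2) * geo 4 + q ^ 3 * ((1 + q ^ 2 - q ^ (s - 3)) * geo 3 * geo 4)"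
      by (simp only:)
    moreover have "fps_nonneg ((1 + q ^ 2 - q ^ (s - 3)) * geo 3 * geo 4)"
      using 4 by (intro less.IH) auto
    ultimately show ?thesis by (simp only: fps_nonneg_intros)
  qed
qed

text \<open>The first two bounds are the wanted ones. The other two exhibit single positive
  coefficients that the induction on \<open>N\<close> feeds back: the coefficient \<open>-1\<close> of \<open>q\<close> at \<open>m = 0\<close>
  reappears at \<open>m = 1\<close> as \<open>-Q * q\<close>, where it must be absorbed. The induction starts at
  \<open>N = 2\<close>, because the series for \<open>N = 1\<close> is \<open>q ^ m / (1 + q)\<close>.\<close>

lemma beta_diff_0_bounds:
  "fps_nonneg (beta_diff 0 (N + 2) (Suc m))" "fps_nonneg (beta_diff 0 (N + 2) 0 + q)"
  "fps_nonneg (beta_diff 0 (N + 2) 1 - q ^ (N + 4))" "fps_nonneg (beta_diff 0 (N + 2) 2 - q ^ 2)"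
proof (induction N arbitrary: m)
  case 0
  have g: "(1 - q ^ 3) * geo 3 = 1" "(1 - q ^ 4) * geo 4 = 1" by (simp_all only: geo_inverse)
  {
    case 1
    show ?case unfolding add_0 beta_diff_2
      by (intro fps_nonneg_intros core_positivity) simp
  next
    case 2
    \<comment> \<open>The numerator \<open>1 - q + q ^ 2 + q * (1 - q ^ 3) * (1 - q ^ 4)\<close> is \<open>(1 - q ^ 4) + q ^ 2 * (1 - q ^ 3) + q ^ 8\<close>.\<close>
    have "beta_diff 0 2 0 + q = geo 3 + q ^ 2 * geo 4 + q ^ 8 * geo 3 * geo 4"
      unfolding beta_diff_2 power_0 add_0 power_one_right using g by algebra
    thus ?case by (simp only: add_0 fps_nonneg_intros)
  next
    case 3
    have "beta_diff 0 2 1 - q ^ 4 = q * geo 4 + q ^ 4 * (q ^ 3 * geo 3 + q ^ 4 * geo 3 * geo 4)"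
      unfolding beta_diff_2 one_add_one power_one_right using g by algebra
    thus ?case by (simp only: add_0 fps_nonneg_intros)
  next
    case 4
    have "2 + 1 = (3 :: nat)" by simp
    hence s: "beta_diff 0 2 2 = q ^ 2 * ((1 + q ^ 2 - q ^ 3) * geo 3 * geo 4)"
      using beta_diff_2[of 2] by (simp only:)
    have "beta_diff 0 2 2 - q ^ 2 = q ^ 2 * (q ^ 4 * geo 4 + q ^ 2 * geo 3 * geo 4)"
      unfolding s using g by algebra
    thus ?case by (simp only: add_0 fps_nonneg_intros)
  }
next
  case (Suc N)
  let ?M = "Suc (N + 2)" and ?A = "beta_diff 0 (N + 2)" and ?B = "beta_diff 0 (Suc (N + 2))"
  let ?Q = "q ^ ?M"
  have lin: "(1 + Q * Q) * (p * x) - Q * (p * y + p * z) = p * ((1 + Q * Q) * x - Q * (y + z))"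
    and lin0: "(1 + Q * Q) * (p * x) - 2 * Q * (p * y) = p * ((1 + Q * Q) * x - 2 * Q * y)"
    for p x y z Q :: "int fps"
    by (simp_all add: algebra_simps)
  have rec: "(1 + ?Q * ?Q) * ?B (Suc m) - ?Q * (?B m + ?B (Suc (Suc m))) = ?A (Suc m)" for m
    unfolding beta_diff_def lin bailey_beta_three_term ..
  have rec0: "(1 + ?Q * ?Q) * ?B 0 - 2 * ?Q * ?B 1 = ?A 0"
    unfolding beta_diff_def lin0 using bailey_beta_three_term_0[of "N + 2"] by (simp only: le_add2 trans_le_add2 one_le_numeral)
  have e: "?Q * q = q ^ (N + 4)" "?Q * q ^ 2 = q ^ (Suc N + 4)"
  proof -
    have n: "N + 4 = ?M + 1" "Suc N + 4 = ?M + 2" by simp_all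
    show "?Q * q = q ^ (N + 4)" "?Q * q ^ 2 = q ^ (Suc N + 4)"
      unfolding n power_add power_one_right by (rule refl)+
  qed
  have "fps_nonneg (?A 1 - ?Q * q)" unfolding e by (rule Suc.IH)
  note * = three_term_positivity[where M = "?M" and e = q, OF zero_less_Suc refl rec rec0 Suc.IH(1,2) this]
  {
    case 1
    show ?case using *(2) by simp
  next
    case 2
    show ?case using *(1) by simp
  next
    case 4
    have "?B 2 - q ^ 2 = (?B 2 - ?A 2) + (?A 2 - q ^ 2)" by simp
    also have "fps_nonneg \<dots>" by (intro fps_nonneg_add *(3) Suc.IH(4))
    finally have B2: "fps_nonneg (?B 2 - q ^ 2)" .
    thus ?case by simp
  next
    case 3
    have "?B 2 - q ^ 2 = (?B 2 - ?A 2) + (?A 2 - q ^ 2)" by simp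
    also have "fps_nonneg \<dots>" by (intro fps_nonneg_add *(3) Suc.IH(4))
    finally have B2: "fps_nonneg (?B 2 - q ^ 2)" .
    have "?B 1 - q ^ (Suc N + 4) = (?B 1 - ?Q * ?B 2) + ?Q * (?B 2 - q ^ 2)"
      unfolding e[symmetric] by (simp only: right_diff_distrib) simp
    also have "fps_nonneg \<dots>" by (intro fps_nonneg_add *(4) fps_nonneg_mult B2 fps_nonneg_power fps_nonneg_X)
    finally show ?case by simp
  }
qed

section \<open>Differences of the \<open>k\<close>-rank numbers for \<open>k \<ge> 2\<close>\<close>

text \<open>In the chain step only the term \<open>j = N\<close> keeps the factor \<open>1 - q\<close>; in every other term
  it is absorbed by \<open>1 / (q)_(N - j)\<close>.\<close>

lemma beta_diff_Suc:
  assumes "N \<ge> 1"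
  shows "beta_diff (Suc i) N m =
    q ^ (N * N) * beta_diff i N m + (\<Sum>j\<in>{1..<N}. q ^ (j * j) * ipoch2 (N - j) * bailey_beta i j m)"
proof -
  have "beta_diff (Suc i) N m = (\<Sum>j\<in>{1..N}. (1 - q) * (q ^ (j * j) * ipoch (N - j) * bailey_beta i j m))"
    by (simp only: beta_diff_def bailey_beta_Suc sum_distrib_left)
  also have "{1..N} = insert N {1..<N}" using assms by auto
  also have "(\<Sum>j\<in>insert N {1..<N}. (1 - q) * (q ^ (j * j) * ipoch (N - j) * bailey_beta i j m)) =
      (1 - q) * (q ^ (N * N) * ipoch (N - N) * bailey_beta i N m)
      + (\<Sum>j\<in>{1..<N}. (1 - q) * (q ^ (j * j) * ipoch (N - j) * bailey_beta i j m))"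
    by (rule sum.insert) auto
  also have "\<dots> = q ^ (N * N) * beta_diff i N m
      + (\<Sum>j\<in>{1..<N}. q ^ (j * j) * ipoch2 (N - j) * bailey_beta i j m)"
    by (simp only: ipoch2_def beta_diff_def diff_self_eq_0 ipoch_0 mult_1_right mult_1 mult_ac)
  finally show ?thesis .
qed

lemma fps_nonneg_bailey_term:
  "j \<ge> 1 \<Longrightarrow> j < N \<Longrightarrow> fps_nonneg (q ^ (j * j) * ipoch2 (N - j) * bailey_beta i j m)"
  using fps_nonneg_ipoch2[of "N - j - 1"]
  by (intro fps_nonneg_mult fps_nonneg_bailey_beta fps_nonneg_power fps_nonneg_X) (auto simp: Suc_diff_Suc)

lemma fps_nonneg_beta_diff:
  assumes "N \<ge> 2"
  shows "fps_nonneg (beta_diff i N (Suc m))"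
proof (induction i)
  case 0
  have "N = (N - 2) + 2" using assms by simp
  thus ?case using beta_diff_0_bounds(1)[of "N - 2" m] by simp
next
  case (Suc i)
  have "N \<ge> 1" using assms by simp
  show ?case unfolding beta_diff_Suc[OF \<open>N \<ge> 1\<close>]
    by (intro fps_nonneg_add fps_nonneg_mult[OF fps_nonneg_power[OF fps_nonneg_X] Suc.IH]
        fps_nonneg_sum fps_nonneg_bailey_term) auto
qed

lemma fps_nonneg_beta_diff_0:
  assumes "N \<ge> 2"
  shows "fps_nonneg (beta_diff i N 0 + q ^ (i * (N * N) + 1))"
proof (induction i)
  case 0
  have "N = (N - 2) + 2" using assms by simp
  thus ?case using beta_diff_0_bounds(2)[of "N - 2"] by simp
next
  case (Suc i)
  have "N \<ge> 1" using assms by simp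
  have e: "q ^ (Suc i * (N * N) + 1) = q ^ (N * N) * q ^ (i * (N * N) + 1)"
    by (simp only: mult_Suc power_add mult.assoc)
  have "beta_diff (Suc i) N 0 + q ^ (Suc i * (N * N) + 1) =
      q ^ (N * N) * (beta_diff i N 0 + q ^ (i * (N * N) + 1))
      + (\<Sum>j\<in>{1..<N}. q ^ (j * j) * ipoch2 (N - j) * bailey_beta i j 0)"
    unfolding beta_diff_Suc[OF \<open>N \<ge> 1\<close>] e by (simp only: distrib_left add_ac)
  also have "fps_nonneg \<dots>"
    by (intro fps_nonneg_add fps_nonneg_mult[OF fps_nonneg_power[OF fps_nonneg_X] Suc.IH]
        fps_nonneg_sum fps_nonneg_bailey_term) auto
  finally show ?case .
qed

lemma krank_N_diff:
  "krank_N k m (int n) - krank_N k m (int n - 1) = fps_nth ((1 - q) * krank_gf k m) n"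
proof (cases n)
  case 0
  thus ?thesis by (simp add: krank_N_def)
next
  case (Suc n')
  have "(1 - q) * krank_gf k m = krank_gf k m - q * krank_gf k m"
    by (simp only: left_diff_distrib mult_1)
  thus ?thesis using Suc by (simp add: krank_N_def nat_add_distrib)
qed

lemma krank_N_diff_bailey_chain:
  assumes "n < J"
  shows "krank_N (int (Suc (Suc i))) (int m) (int n) - krank_N (int (Suc (Suc i))) (int m) (int n - 1)
    = fps_nth (\<Sum>j\<in>{1..J}. q ^ (j * j) * beta_diff i j m) n"
proof -
  have e: "(1 - q) * krank_gf (int (Suc (Suc i))) (int m) - (\<Sum>j\<in>{1..J}. q ^ (j * j) * beta_diff i j m) =
      (1 - q) * (krank_gf (int (Suc (Suc i))) (int m) - (\<Sum>j\<in>{1..J}. q ^ (j * j) * bailey_beta i j m))"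
    unfolding beta_diff_def right_diff_distrib sum_distrib_left by (simp only: mult_ac)
  have "q ^ J dvd (1 - q) * krank_gf (int (Suc (Suc i))) (int m) - (\<Sum>j\<in>{1..J}. q ^ (j * j) * beta_diff i j m)"
    unfolding e by (rule dvd_mult[OF krank_gf_bailey_chain])
  thus ?thesis unfolding krank_N_diff using assms by (rule X_cong_nth)
qed

lemma bailey_beta_order: "q ^ (i + m) dvd bailey_beta i N m"
  unfolding bailey_beta_def
proof (rule dvd_sum)
  fix r assume "r \<in> {1..N}"
  hence r: "r \<ge> 1" by simp
  have "i * 1 \<le> i * (r * r)" using r by (intro mult_le_mono) auto
  hence "q ^ i dvd q ^ (i * (r * r))" by (intro le_imp_power_dvd) simp
  moreover have "m * 1 \<le> m * r" using r by (intro mult_le_mono) auto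
  hence "q ^ m dvd q ^ (r * (r - 1) div 2 + m * r)" by (intro le_imp_power_dvd) linarith
  hence "q ^ m dvd bailey_alpha r m" unfolding bailey_alpha_def by (intro dvd_mult2[OF dvd_mult])
  ultimately show "q ^ (i + m) dvd q ^ (i * (r * r)) * bailey_alpha r m * ipoch (N - r) * ipoch (N + r)"
    unfolding power_add by (intro dvd_mult2 mult_dvd_mono)
qed

lemma sum_split_first:
  assumes "a < J"
  shows "(\<Sum>j\<in>{Suc a..J}. f j) = f (Suc a) + (\<Sum>j\<in>{Suc (Suc a)..J}. f j :: int fps)"
  using assms by (intro sum.atLeast_Suc_atMost) simp

lemma beta_diff_1: "beta_diff i 1 m = q ^ (i + m) * ((1 - q) * geo 2)"
  unfolding beta_diff_def bailey_beta_1 by (simp only: mult_ac)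

lemma one_minus_q_mult_nth: "fps_nth ((1 - q) * f) n = fps_nth f n - (if n = 0 then 0 else fps_nth f (n - 1))"
  by (simp add: left_diff_distrib)

text \<open>The term \<open>j = 1\<close> is \<open>q ^ (k - 1 + m) / (1 + q)\<close> with \<open>k = i + 2\<close>, and all other terms
  start three orders later. This is the exception \<open>n = m + k\<close>.\<close>

lemma krank_drop_at_exception:
  assumes "1 \<le> J"
  shows "fps_nth (\<Sum>j\<in>{1..J}. q ^ (j * j) * beta_diff i j m) (i + m + 2) = -1"
proof -
  have s: "(\<Sum>j\<in>{1..J}. q ^ (j * j) * beta_diff i j m) =
      q * beta_diff i 1 m + (\<Sum>j\<in>{2..J}. q ^ (j * j) * beta_diff i j m)"
    using sum_split_first[of 0 J "\<lambda>j. q ^ (j * j) * beta_diff i j m"] assms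
    by (simp add: numeral_2_eq_2)
  have "q ^ (4 + (i + m)) dvd (\<Sum>j\<in>{2..J}. q ^ (j * j) * beta_diff i j m)"
  proof (rule dvd_sum)
    fix j assume "j \<in> {2..J}"
    hence "2 * 2 \<le> j * j" by (intro mult_le_mono) auto
    hence "q ^ 4 dvd q ^ (j * j)" by (intro le_imp_power_dvd) simp
    thus "q ^ (4 + (i + m)) dvd q ^ (j * j) * beta_diff i j m"
      unfolding power_add[of q 4] beta_diff_def by (intro mult_dvd_mono dvd_mult bailey_beta_order)
  qed
  hence "fps_nth (\<Sum>j\<in>{2..J}. q ^ (j * j) * beta_diff i j m) (i + m + 2) = 0"
    unfolding X_power_dvd_iff by simp
  moreover have "q * beta_diff i 1 m = q ^ (i + m + 1) * ((1 - q) * geo 2)"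
    unfolding beta_diff_1 power_add power_one_right by (simp only: mult_ac)
  hence "fps_nth (q * beta_diff i 1 m) (i + m + 2) = -1"
    by (simp only: fps_X_power_mult_nth one_minus_q_mult_nth geo_nth) simp
  ultimately show ?thesis unfolding s by simp
qed

lemma beta_diff_2_Suc: "beta_diff (Suc i) 2 m = q ^ 4 * beta_diff i 2 m + q ^ (i + m + 1) * geo 2"
proof -
  have s: "{1..<2} = {1::nat}" by auto
  have n: "1 * 1 = (1::nat)" "2 * 2 = (4::nat)" "2 - 1 = Suc (0::nat)" by simp_all
  have "1 \<le> (2::nat)" by simp
  have f: "(\<Sum>r\<in>{1::nat}. f r) = f 1" for f :: "nat \<Rightarrow> int fps" by simp
  show ?thesis
    unfolding beta_diff_Suc[OF \<open>1 \<le> 2\<close>] s f n ipoch2_1 bailey_beta_1 power_add power_one_right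
    by (simp only: mult_ac mult_1)
qed

lemma chain_sum_split:
  assumes "2 \<le> J"
  shows "(\<Sum>j\<in>{1..J}. q ^ (j * j) * beta_diff i j m) =
    q * beta_diff i 1 m + q ^ 4 * beta_diff i 2 m + (\<Sum>j\<in>{3..J}. q ^ (j * j) * beta_diff i j m)"
proof -
  have n: "Suc 0 = 1" "Suc 1 = 2" "Suc 2 = 3" "1 * 1 = (1::nat)" "2 * 2 = (4::nat)" by simp_all
  have J: "0 < J" "1 < J" using assms by simp_all
  show ?thesis
    using sum_split_first[OF J(1), of "\<lambda>j. q ^ (j * j) * beta_diff i j m"]
      sum_split_first[OF J(2), of "\<lambda>j. q ^ (j * j) * beta_diff i j m"]
    unfolding n power_one_right by (simp only: add.assoc)
qed

text \<open>The chain with first entry \<open>2\<close> and all others \<open>1\<close>, which exists for \<open>k = i + 3 \<ge> 3\<close>,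
  contributes \<open>q ^ (k + 2 + m) / (1 - q\<^sup>2)\<close>. It cancels all negative coefficients of
  \<open>q ^ (k - 1 + m) / (1 + q)\<close> except the first one.\<close>

lemma chain_sum_ge_3:
  assumes "2 \<le> J"
  shows "(\<Sum>j\<in>{1..J}. q ^ (j * j) * beta_diff (Suc i) j m) =
    q ^ (i + m + 2) * (geo 2 - q) + q ^ 8 * beta_diff i 2 m + (\<Sum>j\<in>{3..J}. q ^ (j * j) * beta_diff (Suc i) j m)"
proof -
  have g: "(1 - q ^ 2) * geo 2 = 1" by (simp only: geo_inverse)
  have e: "q ^ (Suc i + m) = q * x" "q ^ (i + m + 1) = q * x" "q ^ (i + m + 2) = q ^ 2 * x"
    if "x = q ^ (i + m)" for x
    unfolding that by (simp_all only: add_Suc power_Suc power_add power_one_right mult_ac)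
  have "q * (q * x * ((1 - q) * geo 2)) + q ^ 4 * (q ^ 4 * c + q * x * geo 2) =
      q ^ 2 * x * (geo 2 - q) + q ^ 8 * c" for x c
    using g by algebra
  thus ?thesis
    unfolding chain_sum_split[OF assms] beta_diff_1 beta_diff_2_Suc e[OF refl] by (simp only:)
qed

lemma geo_2_minus_q_nth:
  "n \<noteq> Suc a \<Longrightarrow> 0 \<le> fps_nth (q ^ a * (geo 2 - q)) n"
  by (auto simp: fps_X_power_mult_nth geo_nth)

lemma krank_ge_3_pos:
  assumes "2 \<le> J" "n \<noteq> i + m + 4"
  shows "0 \<le> fps_nth (\<Sum>j\<in>{1..J}. q ^ (j * j) * beta_diff (Suc i) j (Suc m)) n"
proof -
  have "fps_nonneg (q ^ 8 * beta_diff i 2 (Suc m) + (\<Sum>j\<in>{3..J}. q ^ (j * j) * beta_diff (Suc i) j (Suc m)))"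
    by (intro fps_nonneg_add fps_nonneg_sum
        fps_nonneg_mult[OF fps_nonneg_power[OF fps_nonneg_X] fps_nonneg_beta_diff]) auto
  moreover have "0 \<le> fps_nth (q ^ (i + Suc m + 2) * (geo 2 - q)) n"
    by (rule geo_2_minus_q_nth) (use assms in simp)
  ultimately show ?thesis
    unfolding chain_sum_ge_3[OF assms(1)] add.assoc fps_add_nth[of "q ^ _ * (geo 2 - q)"]
    by (intro add_nonneg_nonneg fps_nonnegD[of "_ + _"]) (simp_all only: add.assoc)
qed

lemma nth_mult_ge:
  assumes "fps_nonneg f" "fps_nonneg g"
  shows "fps_nth f i * fps_nth g j \<le> fps_nth (f * g) (i + j)"
proof -
  have "fps_nth f i * fps_nth g ((i + j) - i) \<le> (\<Sum>l=0..i+j. fps_nth f l * fps_nth g (i + j - l))"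
    by (rule member_le_sum) (auto intro!: mult_nonneg_nonneg fps_nonnegD assms)
  thus ?thesis by (simp add: fps_mult_nth)
qed

lemma geo_1_2_pos: "1 \<le> fps_nth (geo 1 * geo 2) n"
  using nth_mult_ge[of "geo 1" "geo 2" n 0] by (simp add: fps_nonneg_geo geo_nth)

lemma geo_2_3_pos: "n \<noteq> 1 \<Longrightarrow> 1 \<le> fps_nth (geo 2 * geo 3) n"
proof (cases "even n")
  case True
  thus ?thesis using nth_mult_ge[of "geo 2" "geo 3" n 0] by (simp add: fps_nonneg_geo geo_nth)
next
  case False
  assume "n \<noteq> 1"
  with False have "n \<ge> 3" by presburger
  thus ?thesis
    using nth_mult_ge[of "geo 2" "geo 3" "n - 3" 3] False by (simp add: fps_nonneg_geo geo_nth)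
qed

lemma geo_3_4_pos: "n \<notin> {1, 2, 5} \<Longrightarrow> 1 \<le> fps_nth (geo 3 * geo 4) n"
proof -
  assume n: "n \<notin> {1, 2, 5}"
  have *: "1 \<le> fps_nth (geo 3 * geo 4) (i + j)" if "3 dvd i" "4 dvd j" for i j
    using nth_mult_ge[of "geo 3" "geo 4" i j] that by (simp add: fps_nonneg_geo geo_nth)
  have "3 dvd n \<or> (n \<ge> 4 \<and> 3 dvd n - 4) \<or> (n \<ge> 8 \<and> 3 dvd n - 8)"
    using n by simp presburger
  thus ?thesis
    using *[of n 0] *[of "n - 4" 4] *[of "n - 8" 8] by auto
qed

text \<open>For \<open>m = 0\<close> and \<open>k \<ge> 4\<close> the chains \<open>(3, 2, 1, \<dots>, 1)\<close> provide a series all of whose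
  coefficients from some order on are positive.\<close>

lemma beta_diff_3_compensation:
  "fps_nonneg (beta_diff (Suc (Suc i)) 3 0 + q ^ (Suc (Suc i) * 9 + 1) - q ^ (i + 5) * (geo 1 * geo 2))"
proof -
  have n: "3 * 3 = (9::nat)" "1 * 1 = (1::nat)" "2 * 2 = (4::nat)" "3 - 1 = Suc (Suc (0::nat))"
    "3 - 2 = Suc (0::nat)" "2 - 1 = Suc (0::nat)" "2 - 2 = (0::nat)" by simp_all
  have s: "{1..<3} = {1, 2::nat}" "{1..2} = {1, 2::nat}" by auto
  have f: "(\<Sum>r\<in>{1,2::nat}. f r) = f 1 + f 2" for f :: "nat \<Rightarrow> int fps" by simp
  have "1 \<le> (3::nat)" by simp
  have b: "bailey_beta (Suc i) 2 0 = q * geo 1 * (q ^ i * geo 2) + q ^ 4 * bailey_beta i 2 0"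
    unfolding bailey_beta_Suc s f n ipoch_0 ipoch_Suc bailey_beta_1 by (simp only: power_one_right power_Suc0_right mult_1 mult_1_right add_0_right One_nat_def)
  have c: "beta_diff (Suc (Suc i)) 3 0 = q ^ 9 * beta_diff (Suc i) 3 0 +
      (q * ipoch2 (Suc (Suc 0)) * bailey_beta (Suc i) 1 0 + q ^ 4 * bailey_beta (Suc i) 2 0)"
    unfolding beta_diff_Suc[OF \<open>1 \<le> 3\<close>] s f n ipoch2_1 by (simp only: power_one_right mult_1_right)
  have e: "q ^ (Suc (Suc i) * 9 + 1) = q ^ 9 * q ^ (Suc i * 9 + 1)" "q ^ (i + 5) = q ^ 4 * q * q ^ i"
  proof -
    have "Suc (Suc i) * 9 + 1 = 9 + (Suc i * 9 + 1)" "i + 5 = 4 + 1 + i" by simp_all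
    thus "q ^ (Suc (Suc i) * 9 + 1) = q ^ 9 * q ^ (Suc i * 9 + 1)" "q ^ (i + 5) = q ^ 4 * q * q ^ i"
      by (simp_all only: power_add power_one_right)
  qed
  have aux: "x9 * c + (r + q4 * (p * g * (y * h) + z)) + x9 * u - q4 * p * y * (g * h) =
    x9 * (c + u) + r + q4 * z" for x9 c r q4 p g y h z u :: "int fps"
    by algebra
  have "fps_nonneg (beta_diff (Suc i) 3 0 + q ^ (Suc i * 9 + 1))"
    using fps_nonneg_beta_diff_0[of 3 "Suc i"] by simp
  thus ?thesis
    unfolding c b e aux
    by (rule fps_nonneg_add[OF fps_nonneg_add[OF fps_nonneg_mult[OF fps_nonneg_power[OF fps_nonneg_X]]]])
       (intro fps_nonneg_mult fps_nonneg_ipoch2 fps_nonneg_bailey_beta fps_nonneg_power fps_nonneg_X, simp)+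
qed

text \<open>For \<open>k = 3\<close> there is no chain \<open>(3, 2, 1)\<close>; the chain \<open>(4, 1)\<close> takes its role.\<close>

lemma beta_diff_4_compensation:
  "fps_nonneg (beta_diff (Suc 0) 4 0 + q ^ 17 - q * (geo 2 * geo 3 * geo 2))"
proof -
  have n: "4 * 4 = (16::nat)" "1 * 1 = (1::nat)" "4 - 1 = Suc (Suc (Suc (0::nat)))" by simp_all
  have r: "ipoch2 (Suc (Suc (Suc 0))) = geo 2 * geo 3"
    unfolding ipoch2_Suc[of "Suc _"] ipoch2_1 by (simp add: numeral_2_eq_2 numeral_3_eq_3)
  have s: "{1..<4} = insert 1 {2..<4::nat}" by auto
  have f: "(\<Sum>r\<in>insert 1 {2..<4::nat}. f r) = f 1 + (\<Sum>r\<in>{2..<4::nat}. f r)" for f :: "nat \<Rightarrow> int fps"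
    by (rule sum.insert) auto
  have "1 \<le> (4::nat)" by simp
  have c: "beta_diff (Suc 0) 4 0 = q ^ 16 * beta_diff 0 4 0 + (q * (geo 2 * geo 3) * geo 2
      + (\<Sum>j\<in>{2..<4}. q ^ (j * j) * ipoch2 (4 - j) * bailey_beta 0 j 0))"
    unfolding beta_diff_Suc[OF \<open>1 \<le> 4\<close>] s f n r bailey_beta_1 by (simp only: power_one_right mult_1 add_0_right power_0)
  have e: "q ^ 17 = q ^ 16 * q"
    by (simp add: power_Suc2[symmetric] del: power_Suc)
  have aux: "x * c + (p * g * h + s) + x * p - p * (g * h) = x * (c + p) + s" for x c p g h s :: "int fps"
    by algebra
  have "fps_nonneg (beta_diff 0 4 0 + q)"
    using fps_nonneg_beta_diff_0[of 4 0] by simp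
  thus ?thesis
    unfolding c e aux
    by (intro fps_nonneg_add[OF fps_nonneg_mult[OF fps_nonneg_power[OF fps_nonneg_X]] fps_nonneg_sum]
        fps_nonneg_bailey_term) auto
qed

text \<open>With distinct exponents each coefficient of the sum is at most one, so a single
  positive coefficient elsewhere compensates it.\<close>

lemma sum_X_power_nth_le:
  fixes e :: "nat \<Rightarrow> nat"
  assumes "finite A" "inj_on e A"
  shows "fps_nth (\<Sum>j\<in>A. q ^ e j) n \<le> 1"
    and "fps_nth (\<Sum>j\<in>A. q ^ e j) n \<noteq> 0 \<Longrightarrow> \<exists>j\<in>A. n = e j"
proof -
  have s: "fps_nth (\<Sum>j\<in>A. q ^ e j) n = (\<Sum>j\<in>A. if n = e j then 1 else 0)"
    by (simp add: fps_sum_nth fps_X_power_nth)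
  show "\<exists>j\<in>A. n = e j" if "fps_nth (\<Sum>j\<in>A. q ^ e j) n \<noteq> 0"
  proof (rule ccontr)
    assume "\<not> ?thesis"
    hence "(\<Sum>j\<in>A. if n = e j then 1 else 0 :: int) = 0" by (intro sum.neutral) auto
    with that s show False by simp
  qed
  show "fps_nth (\<Sum>j\<in>A. q ^ e j) n \<le> 1"
  proof (cases "\<exists>j\<in>A. n = e j")
    case True
    then obtain j where j: "j \<in> A" "n = e j" by blast
    have "(\<Sum>j'\<in>A. if n = e j' then 1 else 0 :: int) = (\<Sum>j'\<in>A. if j' = j then 1 else 0)"
      using j inj_onD[OF assms(2)] by (intro sum.cong) auto
    thus ?thesis unfolding s using assms(1) by (simp add: sum.delta)
  next
    case False
    hence "(\<Sum>j\<in>A. if n = e j then 1 else 0 :: int) = 0" by (intro sum.neutral) auto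
    thus ?thesis unfolding s by simp
  qed
qed

lemma inj_square_exponents: "a > 0 \<Longrightarrow> inj_on (\<lambda>j::nat. a * (j * j) + b) A"
  by (rule inj_onI) (auto dest: power2_eq_imp_eq simp: power2_eq_square[symmetric])

lemma term_nth_le_sum_nth:
  assumes "finite A" "j \<in> A" "\<And>j. j \<in> A \<Longrightarrow> fps_nonneg (f j)"
  shows "fps_nth (f j) n \<le> fps_nth (sum f A) n"
  unfolding fps_sum_nth using assms by (intro member_le_sum) (auto intro: fps_nonnegD)

lemma nth_eq_diff: "a + r = b \<Longrightarrow> fps_nth a n = fps_nth b n - fps_nth r n" for a b r :: "int fps"
  by auto

text \<open>For \<open>m = 0\<close> the diagonal chains \<open>(N, \<dots>, N)\<close> with \<open>N \<ge> 2\<close> may contribute \<open>-1\<close> at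
  \<open>n = (k - 1) * N\<^sup>2 + 1\<close>, with \<open>k = i + 3\<close>. Each of these is compensated by the chains
  singled out above, or for \<open>k = 4\<close> and \<open>N = 2\<close> by \<open>q\<^sup>3 / (1 - q\<^sup>2)\<close>, except for \<open>k = 3\<close>
  and \<open>N = 2\<close>, where \<open>n = 9\<close>.\<close>

lemma krank_ge_3_pos_0:
  assumes "4 \<le> J" "n \<noteq> i + 3" "\<not> (i = 0 \<and> n = 9)"
  shows "0 \<le> fps_nth (\<Sum>j\<in>{1..J}. q ^ (j * j) * beta_diff (Suc i) j 0) n"
proof -
  let ?S = "\<Sum>j\<in>{1..J}. q ^ (j * j) * beta_diff (Suc i) j 0"
  \<comment> \<open>\<open>?R\<close> collects the possible coefficients \<open>-1\<close> of the constant chains; \<open>?S + ?R\<close> is nonnegative up to \<open>?G\<close>.\<close>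
  let ?R = "\<Sum>j\<in>{2..J}. q ^ ((i + 2) * (j * j) + 1)"
  let ?G = "q ^ (i + 2) * (geo 2 - q)"
  let ?C = "q ^ 8 * (beta_diff i 2 0 + q ^ (i * 4 + 1))"
  let ?d = "\<lambda>j. q ^ (j * j) * (beta_diff (Suc i) j 0 + q ^ (Suc i * (j * j) + 1))"
  have J2: "2 \<le> J" "1 < J" using assms by auto
  have n2: "Suc 1 = 2" "Suc 2 = 3" "2 * 2 = (4::nat)" by simp_all
  have R: "?R = q ^ ((i + 2) * 4 + 1) + (\<Sum>j\<in>{3..J}. q ^ ((i + 2) * (j * j) + 1))"
    using sum_split_first[OF J2(2), of "\<lambda>j. q ^ ((i + 2) * (j * j) + 1)"] unfolding n2 .
  have e: "q ^ ((i + 2) * 4 + 1) = q ^ 8 * q ^ (i * 4 + 1)"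
    "q ^ ((i + 2) * (j * j) + 1) = q ^ (j * j) * q ^ (Suc i * (j * j) + 1)" for j
  proof -
    have "(i + 2) * 4 + 1 = 8 + (i * 4 + 1)" "(i + 2) * (j * j) + 1 = j * j + (Suc i * (j * j) + 1)" for j
      by simp_all
    thus "q ^ ((i + 2) * 4 + 1) = q ^ 8 * q ^ (i * 4 + 1)"
      "q ^ ((i + 2) * (j * j) + 1) = q ^ (j * j) * q ^ (Suc i * (j * j) + 1)" for j
      by (simp_all only: power_add)
  qed
  have eq: "?S + ?R = ?G + ?C + (\<Sum>j\<in>{3..J}. ?d j)"
    unfolding chain_sum_ge_3[OF J2(1)] R
    unfolding e sum.distrib distrib_left add_0_right
    by (simp only: add_ac)
  have main: "fps_nth ?S n = fps_nth ?G n + fps_nth ?C n + fps_nth (\<Sum>j\<in>{3..J}. ?d j) n - fps_nth ?R n"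
    using nth_eq_diff[OF eq, of n] by (simp only: fps_add_nth)
  have G: "0 \<le> fps_nth ?G n" by (rule geo_2_minus_q_nth) (use assms(2) in simp)
  have C: "0 \<le> fps_nth ?C n"
    using fps_nonneg_beta_diff_0[of 2 i]
    by (intro fps_nonnegD fps_nonneg_mult[OF fps_nonneg_power[OF fps_nonneg_X]]) simp
  have d: "fps_nonneg (?d j)" if "j \<in> {3..J}" for j
    by (rule fps_nonneg_mult[OF fps_nonneg_power[OF fps_nonneg_X] fps_nonneg_beta_diff_0]) (use that in simp)
  have d_le: "fps_nth (?d j) n \<le> fps_nth (\<Sum>j\<in>{3..J}. ?d j) n" if "j \<in> {3..J}" for j
    by (rule term_nth_le_sum_nth) (use that d in auto)
  have d0: "0 \<le> fps_nth (\<Sum>j\<in>{3..J}. ?d j) n"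
    by (intro fps_nonnegD fps_nonneg_sum d)
  have R1: "fps_nth ?R n \<le> 1"
    by (rule sum_X_power_nth_le[OF _ inj_square_exponents]) auto
  show ?thesis
  proof (cases "fps_nth ?R n = 0")
    case True
    thus ?thesis using main G C d0 by simp
  next
    case False
    have "\<exists>j\<in>{2..J}. n = (i + 2) * (j * j) + 1"
      by (rule sum_X_power_nth_le(2)[OF finite_atLeastAtMost inj_square_exponents False]) simp
    then obtain j where j: "2 \<le> j" and n: "n = (i + 2) * (j * j) + 1" by auto
    have "1 \<le> fps_nth ?G n \<or> 1 \<le> fps_nth (\<Sum>j\<in>{3..J}. ?d j) n"
    proof (cases i)
      case 0
      hence "j \<noteq> 2" using n assms(3) by auto
      hence "3 * 3 \<le> j * j" using j by (intro mult_le_mono) auto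
      hence "n \<ge> 19" using n 0 by simp
      have s: "4 * 4 = (16::nat)" "Suc 0 * 16 + 1 = 17" by simp_all
      have "fps_nth (q * (geo 2 * geo 3 * geo 2)) (n - 16) \<le> fps_nth (beta_diff (Suc 0) 4 0 + q ^ 17) (n - 16)"
        using fps_nonnegD[OF beta_diff_4_compensation, of "n - 16"] by simp
      also have "\<dots> = fps_nth (?d 4) n"
        unfolding 0 s using \<open>n \<ge> 19\<close> by (simp only: fps_X_power_mult_nth) simp
      also have "\<dots> \<le> fps_nth (\<Sum>j\<in>{3..J}. ?d j) n" by (rule d_le) (use assms in simp)
      finally have "fps_nth (geo 2 * geo 3 * geo 2) (n - 17) \<le> fps_nth (\<Sum>j\<in>{3..J}. ?d j) n"
        using \<open>n \<ge> 19\<close> by simp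
      moreover have "fps_nth (geo 2 * geo 3) (n - 17) * fps_nth (geo 2) 0 \<le> fps_nth (geo 2 * geo 3 * geo 2) (n - 17 + 0)"
        by (intro nth_mult_ge fps_nonneg_mult fps_nonneg_geo)
      moreover have "1 \<le> fps_nth (geo 2 * geo 3) (n - 17)"
        by (rule geo_2_3_pos) (use \<open>n \<ge> 19\<close> in simp)
      ultimately show ?thesis by (simp add: geo_nth)
    next
      case (Suc i')
      show ?thesis
      proof (cases "i' = 0 \<and> j = 2")
        case True
        hence "n = 13" "i = 1" using n Suc by auto
        hence "fps_nth ?G n = fps_nth (geo 2 - q) 10"
          by (simp only: fps_X_power_mult_nth) simp
        thus ?thesis by (simp add: geo_nth)
      next
        case False
        \<comment> \<open>From this order on every coefficient of \<open>q ^ (i' + 14) / ((1 - q) * (1 - q ^ 2))\<close> is positive.\<close>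
        have "n \<ge> i' + 14"
        proof (cases "i' = 0")
          case True
          hence "3 * 3 \<le> j * j" using j False by (intro mult_le_mono) auto
          thus ?thesis using n Suc True by simp
        next
          case False
          have "2 * 2 \<le> j * j" using j by (intro mult_le_mono) auto
          hence "(i + 2) * 4 \<le> (i + 2) * (j * j)" by (intro mult_le_mono) auto
          thus ?thesis using n Suc False by simp
        qed
        have s: "3 * 3 = (9::nat)" by simp
        have "1 \<le> fps_nth (geo 1 * geo 2) (n - 9 - (i' + 5))" by (rule geo_1_2_pos)
        also have "\<dots> = fps_nth (q ^ (i' + 5) * (geo 1 * geo 2)) (n - 9)"
          using \<open>n \<ge> i' + 14\<close> by (simp only: fps_X_power_mult_nth) simp
        also have "\<dots> \<le> fps_nth (beta_diff (Suc (Suc i')) 3 0 + q ^ (Suc (Suc i') * 9 + 1)) (n - 9)"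
          using fps_nonnegD[OF beta_diff_3_compensation[of i'], of "n - 9"]
          by (simp only: fps_sub_nth diff_ge_0_iff_ge)
        also have "\<dots> = fps_nth (?d 3) n"
          unfolding Suc s using \<open>n \<ge> i' + 14\<close> by (simp only: fps_X_power_mult_nth) simp
        also have "\<dots> \<le> fps_nth (\<Sum>j\<in>{3..J}. ?d j) n" by (rule d_le) (use assms in simp)
        finally show ?thesis by simp
      qed
    qed
    thus ?thesis using main G C d0 R1 by linarith
  qed
qed

text \<open>Up to the factor \<open>q ^ m\<close> this is \<open>(1 - q) * \<beta>_2\<close> for \<open>s = m + 1\<close>.\<close>

definition rank_core :: "nat \<Rightarrow> int fps" where
  "rank_core s = (1 + q ^ 2 - q ^ s) * geo 3 * geo 4"

lemma fps_nonneg_rank_core: "s \<ge> 2 \<Longrightarrow> fps_nonneg (rank_core s)"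
  unfolding rank_core_def by (rule core_positivity)

lemma rank_core_expand:
  "rank_core 1 = geo 3 + q ^ 2 * geo 4 + q ^ 8 * (geo 3 * geo 4) - q"
  "rank_core 2 = geo 3 * geo 4" "rank_core 3 = geo 4 + q ^ 2 * (geo 3 * geo 4)"
  "rank_core 4 = geo 3 + q ^ 2 * (geo 3 * geo 4)" "rank_core (s + 3) = geo 2 + q ^ 3 * rank_core s"
proof -
  have g: "(1 - q ^ 2) * geo 2 = 1" "(1 - q ^ 3) * geo 3 = 1" "(1 - q ^ 4) * geo 4 = 1"
    by (simp_all only: geo_inverse)
  show "rank_core 1 = geo 3 + q ^ 2 * geo 4 + q ^ 8 * (geo 3 * geo 4) - q"
    unfolding rank_core_def power_one_right using g(2,3) by algebra
  show "rank_core 2 = geo 3 * geo 4" unfolding rank_core_def by algebra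
  show "rank_core 3 = geo 4 + q ^ 2 * (geo 3 * geo 4)" unfolding rank_core_def using g(2) by algebra
  show "rank_core 4 = geo 3 + q ^ 2 * (geo 3 * geo 4)" unfolding rank_core_def using g(3) by algebra
  have "geo 2 = (1 + q ^ 2) * geo 4" using g(1,3) by algebra
  hence "(1 + q ^ 2 - x * q ^ 3) * geo 3 * geo 4 = geo 2 + q ^ 3 * ((1 + q ^ 2 - x) * geo 3 * geo 4)" for x
    using g(2) by algebra
  thus "rank_core (s + 3) = geo 2 + q ^ 3 * rank_core s" unfolding rank_core_def power_add .
qed

text \<open>For \<open>s \<ge> 5\<close> the recursion \<open>s \<rightarrow> s - 3\<close> splits off \<open>1 / (1 - q\<^sup>2)\<close>, which covers all
  even exponents. The two excluded pairs for smaller \<open>s\<close> are sporadic exceptions of the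
  theorem.\<close>

lemma rank_core_even_pos:
  assumes "s \<ge> 2" "even t" "\<not> (s = 2 \<and> t = 2)" "\<not> (s = 4 \<and> t = 4)"
  shows "1 \<le> fps_nth (rank_core s) t"
proof -
  consider "s = 2" | "s = 3" | "s = 4" | "s \<ge> 5" using assms(1) by linarith
  thus ?thesis
  proof cases
    case 1
    hence "t \<notin> {1, 2, 5}" using assms(2,3) by auto
    thus ?thesis unfolding 1 rank_core_expand by (rule geo_3_4_pos)
  next
    case 2
    have "t = 0 \<or> t = 4 \<or> t = 2 \<or> (t \<ge> 6 \<and> t - 2 \<notin> {1, 2, 5})" using assms(2) by (simp, presburger)
    moreover have "0 \<le> fps_nth (geo 3 * geo 4) (t - 2)"
      by (intro fps_nonnegD fps_nonneg_mult fps_nonneg_geo)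
    ultimately show ?thesis
      unfolding 2 rank_core_expand fps_add_nth fps_X_power_mult_nth
      using geo_3_4_pos[of "t - 2"] by (auto simp: geo_nth)
  next
    case 3
    have "t = 0 \<or> t = 2 \<or> (t \<ge> 6 \<and> t - 2 \<notin> {1, 2, 5})" using assms(2,4) 3 by (simp, presburger)
    moreover have "0 \<le> fps_nth (geo 3 * geo 4) (t - 2)"
      by (intro fps_nonnegD fps_nonneg_mult fps_nonneg_geo)
    ultimately show ?thesis
      unfolding 3 rank_core_expand fps_add_nth fps_X_power_mult_nth
      using geo_3_4_pos[of "t - 2"] by (auto simp: geo_nth)
  next
    case 4
    hence s: "s = (s - 3) + 3" by simp
    have "0 \<le> fps_nth (q ^ 3 * rank_core (s - 3)) t"
      using 4 by (intro fps_nonnegD fps_nonneg_mult fps_nonneg_power fps_nonneg_X fps_nonneg_rank_core) simp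
    moreover have "fps_nth (geo 2) t = 1" using assms(2) by (simp add: geo_nth)
    ultimately show ?thesis
      by (subst s, unfold rank_core_expand fps_add_nth) simp
  qed
qed

text \<open>For \<open>k = 2\<close> the negative coefficients of \<open>q ^ (m + 1) / (1 + q)\<close> have to be
  compensated by the term \<open>j = 2\<close>.\<close>

lemma chain_sum_2:
  assumes "2 \<le> J"
  shows "(\<Sum>j\<in>{1..J}. q ^ (j * j) * beta_diff 0 j m) =
    q ^ (m + 1) * ((1 - q) * geo 2 + q ^ 3 * rank_core (m + 1)) + (\<Sum>j\<in>{3..J}. q ^ (j * j) * beta_diff 0 j m)"
proof -
  have "q * (x * ((1 - q) * geo 2)) + q ^ 4 * (x * h) = x * q * ((1 - q) * geo 2 + q ^ 3 * h)" for x h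
    by algebra
  thus ?thesis
    unfolding chain_sum_split[OF assms] beta_diff_1 beta_diff_2 rank_core_def[symmetric]
    unfolding add_0 power_add[of q m 1] power_one_right
    by (simp only:)
qed

lemma rank_main_nth:
  "fps_nth ((1 - q) * geo 2 + q ^ 3 * h) d =
    (if even d then 1 else -1) + (if d < 3 then 0 else fps_nth h (d - 3))"
proof -
  have "fps_nth ((1 - q) * geo 2) d = (if even d then 1 else -1)"
    by (cases d) (auto simp: one_minus_q_mult_nth geo_nth)
  thus ?thesis by (simp only: fps_add_nth fps_X_power_mult_nth)
qed

lemma krank_2_pos:
  assumes "2 \<le> J" "m \<ge> 1" "n \<noteq> m + 2" "(m, n) \<notin> {(1, 7), (3, 11)}"
  shows "0 \<le> fps_nth (\<Sum>j\<in>{1..J}. q ^ (j * j) * beta_diff 0 j m) n"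
proof -
  obtain m' where m': "m = Suc m'" using assms(2) by (cases m) auto
  have "fps_nonneg (\<Sum>j\<in>{3..J}. q ^ (j * j) * beta_diff 0 j m)"
    unfolding m'
    by (intro fps_nonneg_sum fps_nonneg_mult[OF fps_nonneg_power[OF fps_nonneg_X] fps_nonneg_beta_diff]) auto
  moreover have "0 \<le> fps_nth (q ^ (m + 1) * ((1 - q) * geo 2 + q ^ 3 * rank_core (m + 1))) n"
  proof (cases "n < m + 1")
    case False
    then obtain d where n: "n = m + 1 + d" by (metis le_Suc_ex not_less)
    have "0 \<le> (if even d then 1 else -1) + (if d < 3 then 0 else fps_nth (rank_core (m + 1)) (d - 3))"
    proof (cases "even d")
      case True
      thus ?thesis using fps_nonnegD[OF fps_nonneg_rank_core[of "m + 1"], of "d - 3"] assms(2) by simp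
    next
      case False
      hence "d \<ge> 3" using n assms(3) by (cases "d = 1") (auto, presburger)
      have "1 \<le> fps_nth (rank_core (m + 1)) (d - 3)"
      proof (rule rank_core_even_pos)
        show "even (d - 3)" using False \<open>d \<ge> 3\<close> by presburger
        show "\<not> (m + 1 = 2 \<and> d - 3 = 2)" "\<not> (m + 1 = 4 \<and> d - 3 = 4)"
          using assms(4) n \<open>d \<ge> 3\<close> by auto
      qed (use assms in auto)
      thus ?thesis using \<open>d \<ge> 3\<close> by auto
    qed
    moreover have "n - (m + 1) = d" using n by simp
    ultimately show ?thesis by (simp only: fps_X_power_mult_nth rank_main_nth False if_False)
  qed (simp only: fps_X_power_mult_nth if_True)
  ultimately show ?thesis
    unfolding chain_sum_2[OF assms(1)] fps_add_nth[of "q ^ _ * _"]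
    by (intro add_nonneg_nonneg) (auto dest: fps_nonnegD)
qed

lemma rank_core_1_nth:
  "fps_nth (rank_core 1) t = (if 3 dvd t then 1 else 0) + (if t \<ge> 2 \<and> 4 dvd t - 2 then 1 else 0)
     + (if t < 8 then 0 else fps_nth (geo 3 * geo 4) (t - 8)) - (if t = 1 then 1 else 0)"
  unfolding rank_core_expand fps_add_nth fps_sub_nth fps_X_power_mult_nth geo_nth fps_X_nth by simp

text \<open>As for larger \<open>k\<close>, the terms \<open>j \<ge> 3\<close> may contribute \<open>-1\<close> at \<open>n = j\<^sup>2 + 1\<close>. If \<open>j\<close> is
  even, \<open>1 / (1 + q)\<close> compensates this. If \<open>j\<close> is odd, then \<open>j\<^sup>2 \<equiv> 1 (mod 8)\<close>, so that
  \<open>j\<^sup>2 - 5\<close> is a multiple of four and \<open>rank_core 1\<close> has a coefficient of at least two at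
  \<open>j\<^sup>2 - 3\<close>.\<close>

lemma krank_2_pos_0:
  assumes "2 \<le> J" "n \<noteq> 2" "n \<noteq> 8"
  shows "0 \<le> fps_nth (\<Sum>j\<in>{1..J}. q ^ (j * j) * beta_diff 0 j 0) n"
proof (cases n)
  case 0
  have "fps_nth (\<Sum>j\<in>{1..J}. q ^ (j * j) * beta_diff 0 j 0) 0 = 0"
    by (simp add: fps_sum_nth)
  thus ?thesis using 0 by simp
next
  case (Suc d)
  let ?S = "\<Sum>j\<in>{1..J}. q ^ (j * j) * beta_diff 0 j 0"
  let ?R = "\<Sum>j\<in>{3..J}. q ^ (1 * (j * j) + 1)"
  let ?D = "\<Sum>j\<in>{3..J}. q ^ (j * j) * (beta_diff 0 j 0 + q)"
  let ?e = "(if even d then 1 else -1) + (if d < 3 then 0 else fps_nth (rank_core 1) (d - 3))"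
  have eq: "?S + ?R = q * ((1 - q) * geo 2 + q ^ 3 * rank_core 1) + ?D"
    unfolding chain_sum_2[OF assms(1)] add_0 power_one_right mult_1 power_add distrib_left sum.distrib
    by (simp only: add_ac)
  have "fps_nth ?S n = fps_nth (q * ((1 - q) * geo 2 + q ^ 3 * rank_core 1)) n + fps_nth ?D n - fps_nth ?R n"
    using nth_eq_diff[OF eq, of n] by (simp only: fps_add_nth)
  also have "fps_nth (q * ((1 - q) * geo 2 + q ^ 3 * rank_core 1)) n = ?e"
    unfolding Suc rank_main_nth[symmetric] by simp
  finally have main: "fps_nth ?S n = ?e + fps_nth ?D n - fps_nth ?R n" .
  have "fps_nonneg (beta_diff 0 j 0 + q)" if "j \<in> {3..J}" for j
    using fps_nonneg_beta_diff_0[of j 0] that by simp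
  hence D: "0 \<le> fps_nth ?D n"
    by (intro fps_nonnegD fps_nonneg_sum fps_nonneg_mult[OF fps_nonneg_power[OF fps_nonneg_X]])
  have R1: "fps_nth ?R n \<le> 1"
    by (rule sum_X_power_nth_le[OF _ inj_square_exponents]) auto
  have g: "0 \<le> fps_nth (geo 3 * geo 4) s" for s
    by (intro fps_nonnegD fps_nonneg_mult fps_nonneg_geo)
  have d: "d \<noteq> 1" "d \<noteq> 7" using assms Suc by auto
  have H0: "0 \<le> fps_nth (rank_core 1) t" if "t \<noteq> 1" for t
    using g[of "t - 8"] that unfolding rank_core_1_nth by simp
  have H1: "fps_nth (rank_core 1) 1 = -1" unfolding rank_core_1_nth by simp
  have e0: "0 \<le> ?e"
  proof (cases "even d")
    case True
    thus ?thesis using H0[of "d - 3"] H1 by (cases "d - 3 = 1") auto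
  next
    case False
    hence d3: "d \<ge> 3" using d by presburger
    hence t: "even (d - 3)" "d - 3 \<noteq> 4" using False d by presburger+
    have "1 \<le> fps_nth (rank_core 1) (d - 3)"
    proof -
      have "1 \<le> fps_nth (rank_core 1) u" if "even u" "u \<noteq> 4" for u
      proof -
        have "u \<in> {0, 2, 6, 10, 12} \<or> (u \<ge> 8 \<and> u - 8 \<notin> {1, 2, 5})"
          using that by (simp, presburger)
        thus ?thesis
          unfolding rank_core_1_nth using g[of "u - 8"] geo_3_4_pos[of "u - 8"] by (elim disjE) auto
      qed
      from this[OF t] show ?thesis .
    qed
    thus ?thesis using d3 False by auto
  qed
  show ?thesis
  proof (cases "fps_nth ?R n = 0")
    case True
    thus ?thesis using main e0 D by simp
  next
    case False
    have "\<exists>j\<in>{3..J}. n = 1 * (j * j) + 1"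
      by (rule sum_X_power_nth_le(2)[OF finite_atLeastAtMost inj_square_exponents False]) simp
    then obtain j where j: "3 \<le> j" and dj: "d = j * j" using Suc by auto
    have d9: "9 \<le> d" using mult_le_mono[OF j j] dj by simp
    have "1 \<le> ?e"
    proof (cases "even d")
      case True
      thus ?thesis using H0[of "d - 3"] d9 by auto
    next
      case False
      hence "odd j" using dj by simp
      then obtain a where a: "j = 2 * a + 1" by (elim oddE)
      have da: "d = 4 * (a * a + a) + 1" unfolding dj a by (simp add: algebra_simps)
      have "even (a * a + a)" by simp
      then obtain b where "a * a + a = 2 * b" by (elim evenE)
      hence db: "d = 8 * b + 1" using da by simp
      have four: "4 dvd d - 3 - 2"
      proof -
        have "d - 3 - 2 = 4 * (2 * b - 1)" using db d9 by simp
        thus ?thesis by (metis dvd_triv_left)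
      qed
      have "2 \<le> fps_nth (rank_core 1) (d - 3)"
      proof (cases "d = 9")
        case True
        thus ?thesis unfolding rank_core_1_nth True by simp
      next
        case False
        hence "d \<ge> 17" using db d9 by presburger
        hence "1 \<le> fps_nth (geo 3 * geo 4) (d - 3 - 8)" by (intro geo_3_4_pos) auto
        thus ?thesis unfolding rank_core_1_nth using four \<open>d \<ge> 17\<close> by simp
      qed
      thus ?thesis using d9 by simp
    qed
    thus ?thesis using main D R1 by linarith
  qed
qed

section \<open>A sum formula for the crank\<close>

text \<open>Iterating the functional equation pushes \<open>E\<close> to arbitrarily high order; for \<open>m = 0\<close>
  and \<open>s = 0\<close> one step leads to \<open>m = 1\<close>, where the iteration gains a power of \<open>q\<close> each
  time.\<close>

lemma X_cong_functional_eq: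
  assumes "\<And>m. q ^ J dvd E m + q ^ (m + s) * E (Suc m)"
  shows "q ^ J dvd E m"
proof -
  have pos: "\<forall>m. q ^ K dvd E (Suc m)" if "K \<le> J" for K
    using that
  proof (induction K)
    case (Suc K)
    show ?case
    proof
      fix m
      have "q ^ Suc K dvd q ^ J" using Suc.prems by (rule le_imp_power_dvd)
      hence 1: "q ^ Suc K dvd E (Suc m) + q ^ (Suc m + s) * E (Suc (Suc m))"
        using assms dvd_trans by blast
      have "q ^ 1 dvd q ^ (Suc m + s)" by (rule le_imp_power_dvd) simp
      moreover have "q ^ K dvd E (Suc (Suc m))" using Suc by simp
      ultimately have "q ^ 1 * q ^ K dvd q ^ (Suc m + s) * E (Suc (Suc m))"
        by (rule mult_dvd_mono)
      hence "q ^ Suc K dvd q ^ (Suc m + s) * E (Suc (Suc m))" by simp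
      with 1 show "q ^ Suc K dvd E (Suc m)" by (simp only: dvd_add_left_iff)
    qed
  qed simp
  have "q ^ J dvd q ^ (m + s) * E (Suc m)" using pos[of J] by (intro dvd_mult) simp
  with assms[of m] show ?thesis by (simp only: dvd_add_left_iff)
qed

text \<open>Partial sum of the false theta series for which \<open>\<Sum>r. \<alpha>_r\<close> is the difference of the
  values at \<open>m\<close> and \<open>m + 1\<close>.\<close>

definition theta_partial :: "nat \<Rightarrow> nat \<Rightarrow> int fps" where
  "theta_partial J m = (\<Sum>r<J. (-1) ^ r * q ^ (Suc r * r div 2 + m * Suc r))"

definition durfee_sum :: "nat \<Rightarrow> nat \<Rightarrow> int fps" where
  "durfee_sum J m = (\<Sum>j\<le>J. q ^ (Suc j * (j + m)) * ipoch j * ipoch (j + m))"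

definition crank_sum :: "nat \<Rightarrow> nat \<Rightarrow> int fps" where
  "crank_sum J m = (\<Sum>j\<le>J. q ^ (j + Suc j * (j + m)) * ipoch j * ipoch (j + m))"

lemma theta_partial_rec: "q ^ J dvd theta_partial J m + q ^ m * theta_partial J (Suc m) - q ^ m"
proof -
  let ?t = "\<lambda>r. (-1) ^ r * q ^ (Suc r * r div 2 + m * Suc r)"
  have "theta_partial (Suc J) m = ?t 0 + (\<Sum>r<J. ?t (Suc r))"
    unfolding theta_partial_def by (rule sum.lessThan_Suc_shift)
  also have "(\<Sum>r<J. ?t (Suc r)) = - (q ^ m * theta_partial J (Suc m))"
    unfolding theta_partial_def sum_distrib_left sum_negf[symmetric]
  proof (rule sum.cong[OF refl])
    fix r
    have p: "(-1) ^ Suc r = - ((-1) ^ r :: int fps)" by simp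
    have "Suc (Suc r) * Suc r div 2 + m * Suc (Suc r) = m + (Suc r * r div 2 + Suc m * Suc r)"
      using triangular_Suc[of "Suc r"] by simp
    thus "?t (Suc r) = - (q ^ m * ((-1) ^ r * q ^ (Suc r * r div 2 + Suc m * Suc r)))"
      by (simp only: power_add[of q m] p mult_minus_left mult_minus_right mult.left_commute)
  qed
  also have "theta_partial (Suc J) m = theta_partial J m + ?t J"
    unfolding theta_partial_def by (rule sum.lessThan_Suc)
  also have "?t 0 = q ^ m" by simp
  finally have "theta_partial J m + ?t J = q ^ m + - (q ^ m * theta_partial J (Suc m))" .
  moreover have "a + y - x = - t" if "a + t = x + - y" for a t x y :: "int fps"
    using that by algebra
  ultimately have "theta_partial J m + q ^ m * theta_partial J (Suc m) - q ^ m = - ?t J"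
    by blast
  moreover have "q ^ J dvd ?t J"
  proof -
    have "J \<le> Suc J * J div 2 + m * Suc J"
    proof (cases J)
      case (Suc J')
      have "J * 2 \<le> Suc J * J" unfolding Suc by simp
      thus ?thesis by linarith
    qed simp
    thus ?thesis by (intro dvd_mult le_imp_power_dvd)
  qed
  ultimately show ?thesis by simp
qed

text \<open>The factor \<open>1 - q ^ j\<close> removes the term \<open>j = 0\<close> and turns \<open>1 / (q)_j\<close> into
  \<open>1 / (q)_(j - 1)\<close>; this is how the functional equations in \<open>m\<close> arise.\<close>

lemma sum_ipoch_shift:
  "(\<Sum>j\<le>J. c j * (1 - q ^ j) * ipoch j * ipoch (j + m)) = (\<Sum>j<J. c (Suc j) * ipoch j * ipoch (j + Suc m))"
proof -
  have "(\<Sum>j\<le>J. c j * (1 - q ^ j) * ipoch j * ipoch (j + m)) =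
      c 0 * (1 - q ^ 0) * ipoch 0 * ipoch (0 + m) + (\<Sum>j<J. c (Suc j) * (1 - q ^ Suc j) * ipoch (Suc j) * ipoch (Suc j + m))"
    by (rule sum.atMost_shift)
  also have "(\<Sum>j<J. c (Suc j) * (1 - q ^ Suc j) * ipoch (Suc j) * ipoch (Suc j + m)) =
      (\<Sum>j<J. c (Suc j) * ipoch j * ipoch (j + Suc m))"
  proof (rule sum.cong[OF refl])
    fix j
    show "c (Suc j) * (1 - q ^ Suc j) * ipoch (Suc j) * ipoch (Suc j + m) = c (Suc j) * ipoch j * ipoch (j + Suc m)"
      unfolding ipoch_eq[of j] by (simp only: mult.assoc add_Suc add_Suc_right)
  qed
  finally show ?thesis by simp
qed

lemma durfee_sum_rec: "q ^ J dvd durfee_sum J m + q ^ m * durfee_sum J (Suc m) - q ^ m * ipoch_inf"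
proof -
  let ?c = "\<lambda>j. q ^ (j * (j + m))"
  have aux: "a + x * b - x * P = x * (d - P) + x * l" if "a + x * s = x * d" "b = s + l"
    for a b d s l x P :: "int fps"
    using that by algebra
  have e: "q ^ (Suc j * (j + m)) = q ^ m * (q ^ j * ?c j)" for j
  proof -
    have "Suc j * (j + m) = m + (j + j * (j + m))" by simp
    thus ?thesis by (simp only: power_add)
  qed
  have aux': "x * (y * c) * u * v + x * (c * (1 - y) * u * v) = x * (c * u * v)"
    for x y c u v :: "int fps"
    by algebra
  have "durfee_sum J m + q ^ m * (\<Sum>j<J. ?c (Suc j) * ipoch j * ipoch (j + Suc m)) =
      q ^ m * (\<Sum>j\<le>J. ?c j * ipoch j * ipoch (j + m))"
    unfolding durfee_sum_def sum_ipoch_shift[where c = ?c and m = m, symmetric] sum_distrib_left sum.distrib[symmetric] e aux' ..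
  moreover have "durfee_sum J (Suc m) = (\<Sum>j<J. ?c (Suc j) * ipoch j * ipoch (j + Suc m)) + ?c (Suc J) * ipoch J * ipoch (J + Suc m)"
    unfolding durfee_sum_def lessThan_Suc_atMost[symmetric] by (simp only: sum.lessThan_Suc add_Suc add_Suc_right)
  ultimately have eq: "durfee_sum J m + q ^ m * durfee_sum J (Suc m) - q ^ m * ipoch_inf =
      q ^ m * ((\<Sum>j\<le>J. ?c j * ipoch j * ipoch (j + m)) - ipoch_inf) + q ^ m * (?c (Suc J) * ipoch J * ipoch (J + Suc m))"
    by (rule aux)
  have "J \<le> Suc J * (Suc J + m)" by simp
  hence 1: "q ^ J dvd q ^ m * (?c (Suc J) * ipoch J * ipoch (J + Suc m))"
    by (rule dvd_mult[OF dvd_mult2[OF dvd_mult2[OF le_imp_power_dvd]]])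
  show ?thesis
    unfolding eq by (rule dvd_add[OF dvd_mult[OF durfee_limit] 1])
qed

text \<open>Divided by \<open>(q)_\<infinity>\<close>, the false theta series counts partitions whose crank is at least
  \<open>m\<close>, with the usual convention for \<open>n = 1\<close>. Both sides satisfy the same functional
  equation \<open>F m + q ^ m * F (m + 1) = q ^ m / (q)_\<infinity>\<close>.\<close>

lemma theta_partial_durfee: "q ^ J dvd ipoch_inf * theta_partial J m - durfee_sum J m"
proof (rule X_cong_functional_eq[where s = 0])
  fix m
  have aux: "P * t0 - q0 + x * (P * t1 - q1) = P * (t0 + x * t1 - x) - (q0 + x * q1 - x * P)"
    for P t0 t1 q0 q1 x :: "int fps"
    by algebra
  have "ipoch_inf * theta_partial J m - durfee_sum J m + q ^ (m + 0) * (ipoch_inf * theta_partial J (Suc m) - durfee_sum J (Suc m)) =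
      ipoch_inf * (theta_partial J m + q ^ m * theta_partial J (Suc m) - q ^ m)
      - (durfee_sum J m + q ^ m * durfee_sum J (Suc m) - q ^ m * ipoch_inf)"
    unfolding add_0_right by (rule aux)
  also have "q ^ J dvd \<dots>"
    by (rule dvd_diff[OF dvd_mult[OF theta_partial_rec] durfee_sum_rec])
  finally show "q ^ J dvd ipoch_inf * theta_partial J m - durfee_sum J m
      + q ^ (m + 0) * (ipoch_inf * theta_partial J (Suc m) - durfee_sum J (Suc m))" .
qed

lemma crank_sum_rec: "q ^ J dvd crank_sum J m + q ^ Suc m * crank_sum J (Suc m) - durfee_sum J m"
proof -
  let ?c = "\<lambda>j. q ^ (Suc j * (j + m))"
  have e: "q ^ (j + Suc j * (j + m)) = q ^ j * ?c j" for j
    by (simp only: power_add)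
  have e': "q ^ Suc m * q ^ (j + Suc j * (j + Suc m)) = ?c (Suc j)" for j
    unfolding power_add[symmetric] by (rule arg_cong[where f = "\<lambda>n. q ^ n"]) simp
  have "crank_sum J m + (\<Sum>j<J. ?c (Suc j) * ipoch j * ipoch (j + Suc m)) = durfee_sum J m"
    unfolding durfee_sum_def crank_sum_def sum_ipoch_shift[where c = ?c and m = m, symmetric] sum.distrib[symmetric] e
    by (intro sum.cong refl) (simp add: algebra_simps)
  moreover have "q ^ Suc m * crank_sum J (Suc m) =
      (\<Sum>j<J. ?c (Suc j) * ipoch j * ipoch (j + Suc m)) + ?c (Suc J) * ipoch J * ipoch (J + Suc m)"
    unfolding crank_sum_def sum_distrib_left mult.assoc[symmetric] e' lessThan_Suc_atMost[symmetric]
    by (simp only: sum.lessThan_Suc)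
  ultimately have "crank_sum J m + q ^ Suc m * crank_sum J (Suc m) - durfee_sum J m = ?c (Suc J) * ipoch J * ipoch (J + Suc m)"
    by (simp only: add.assoc[symmetric] add_diff_cancel_left')
  moreover have "J \<le> Suc (Suc J) * (Suc J + m)" by simp
  hence "q ^ J dvd ?c (Suc J) * ipoch J * ipoch (J + Suc m)"
    by (intro dvd_mult2 le_imp_power_dvd)
  ultimately show ?thesis by (simp only:)
qed

lemma sum_bailey_alpha: "(\<Sum>r\<in>{1..J}. bailey_alpha r m) = theta_partial J m - theta_partial J (Suc m)"
  unfolding One_nat_def sum.atLeast1_atMost_eq theta_partial_def sum_subtractf[symmetric]
proof (rule sum.cong[OF refl])
  fix r
  have "q ^ (Suc r * r div 2 + Suc m * Suc r) = q ^ (Suc r * r div 2 + m * Suc r) * q ^ Suc r"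
  proof -
    have "Suc r * r div 2 + Suc m * Suc r = (Suc r * r div 2 + m * Suc r) + Suc r" by simp
    thus ?thesis by (simp only: power_add)
  qed
  moreover have "s * x * (1 - y) = s * x - s * (x * y)" for s x y :: "int fps" by algebra
  ultimately show "bailey_alpha (Suc r) m = (-1) ^ r * q ^ (Suc r * r div 2 + m * Suc r)
      - (-1) ^ r * q ^ (Suc r * r div 2 + Suc m * Suc r)"
    unfolding bailey_alpha_def diff_Suc_1 by (simp only:)
qed

text \<open>A formula for the crank without alternating signs. The two sides \<open>F\<close> satisfy
  \<open>F m + q ^ (m + 1) * F (m + 1) = (1 - q) * G m\<close>, where \<open>G m\<close> is the false theta series
  over \<open>(q)_\<infinity>\<close>, and this determines \<open>F\<close>.\<close>

lemma crank_gf: "q ^ J dvd krank_gf 1 (int m) - (1 - q) * crank_sum J m"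
proof -
  have 1: "q ^ J dvd ipoch_inf * (theta_partial J m - theta_partial J (Suc m)) - (1 - q) * crank_sum J m"
  proof (rule X_cong_functional_eq[where s = 1])
    fix m
    let ?T = "theta_partial J" and ?H = "crank_sum J"
    have e: "q ^ (m + 1) = q * q ^ m" "q ^ Suc m = q * q ^ m" by simp_all
    have aux: "P * (t0 - t1) - (1 - p) * h0 + p * x * (P * (t1 - t2) - (1 - p) * h1) =
      P * (p * (t0 + x * t1 - x) - (t1 + p * x * t2 - p * x))
      + (1 - p) * ((P * t0 - Q) - (h0 + p * x * h1 - Q))" for P t0 t1 t2 h0 h1 p x Q :: "int fps"
      by algebra
    have "ipoch_inf * (?T m - ?T (Suc m)) - (1 - q) * ?H m
        + q ^ (m + 1) * (ipoch_inf * (?T (Suc m) - ?T (Suc (Suc m))) - (1 - q) * ?H (Suc m)) =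
      ipoch_inf * (q * (?T m + q ^ m * ?T (Suc m) - q ^ m) - (?T (Suc m) + q ^ Suc m * ?T (Suc (Suc m)) - q ^ Suc m))
      + (1 - q) * ((ipoch_inf * ?T m - durfee_sum J m) - (?H m + q ^ Suc m * ?H (Suc m) - durfee_sum J m))"
      unfolding e by (rule aux)
    also have "q ^ J dvd \<dots>"
      by (rule dvd_add[OF dvd_mult[OF dvd_diff[OF dvd_mult[OF theta_partial_rec] theta_partial_rec]]
            dvd_mult[OF dvd_diff[OF theta_partial_durfee crank_sum_rec]]])
    finally show "q ^ J dvd ipoch_inf * (?T m - ?T (Suc m)) - (1 - q) * ?H m
        + q ^ (m + 1) * (ipoch_inf * (?T (Suc m) - ?T (Suc (Suc m))) - (1 - q) * ?H (Suc m))" .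
  qed
  have 2: "q ^ J dvd krank_gf 1 (int m) - ipoch_inf * (theta_partial J m - theta_partial J (Suc m))"
  proof -
    have "int (Suc 0) = 1" by simp
    thus ?thesis
      using krank_gf_cong[of J 0 m] unfolding mult_0 power_0 mult_1 sum_bailey_alpha by (simp only:)
  qed
  show ?thesis by (rule X_cong_trans[OF 2 1])
qed

section \<open>Differences of the crank numbers\<close>

lemma ipoch2_Suc_Suc: "ipoch2 (Suc (Suc n)) = ipoch2 (Suc n) * geo (Suc (Suc n))"
  by (rule ipoch2_Suc)

lemma ipoch2_numerals:
  "ipoch2 2 = geo 2" "ipoch2 3 = geo 2 * geo 3" "ipoch2 4 = geo 2 * geo 3 * geo 4"
  "ipoch2 5 = geo 2 * geo 3 * geo 4 * geo 5" "ipoch2 6 = geo 2 * geo 3 * geo 4 * geo 5 * geo 6"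
  "ipoch2 7 = geo 2 * geo 3 * geo 4 * geo 5 * geo 6 * geo 7"
  by (simp_all add: numeral_eq_Suc ipoch2_Suc_Suc ipoch2_1 mult.assoc)

lemma geo_mult_nth:
  assumes "s > 0"
  shows "fps_nth (f * geo s) n = fps_nth f n + (if n < s then 0 else fps_nth (f * geo s) (n - s))"
proof -
  have "(1 - q ^ s) * geo s = 1" using assms by (rule geo_inverse)
  moreover have "f * g = f + x * (f * g)" if "(1 - x) * g = 1" for f g x :: "int fps"
    using that by algebra
  ultimately have "f * geo s = f + q ^ s * (f * geo s)" by blast
  hence "fps_nth (f * geo s) n = fps_nth (f + q ^ s * (f * geo s)) n" by (rule arg_cong)
  thus ?thesis by (simp only: fps_add_nth fps_X_power_mult_nth)
qed

lemma fps_nonneg_minus_X_power: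
  assumes "fps_nonneg f" "1 \<le> fps_nth f n"
  shows "fps_nonneg (f - q ^ n)"
  using assms by (auto simp: fps_nonneg_def fps_X_power_nth)

text \<open>The only part of the difference series that can be negative comes from \<open>j = 0\<close>. For
  \<open>m \<ge> 1\<close> it counts partitions of \<open>n\<close> into parts \<open>2, \<dots>, m\<close> minus such partitions of
  \<open>n - 1\<close>.\<close>

definition crank_head :: "nat \<Rightarrow> int fps" where "crank_head m = (1 - q) * ipoch2 m"

lemma crank_head_Suc: "crank_head (Suc m) = crank_head m * geo (Suc m)"
  unfolding crank_head_def ipoch2_Suc by (rule mult.assoc[symmetric])

lemma crank_split:
  assumes "J \<ge> 1"
  shows "(1 - q) * ((1 - q) * crank_sum J m) = q ^ m * (crank_head m + q ^ (m + 3) * ipoch2 (Suc m))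
    + (\<Sum>j\<in>{2..J}. q ^ (j + Suc j * (j + m)) * ipoch2 j * ipoch2 (j + m))"
proof -
  let ?f = "\<lambda>j. q ^ (j + Suc j * (j + m)) * ipoch2 j * ipoch2 (j + m)"
  have t: "(1 - p) * ((1 - p) * (x * u * v)) = x * ((1 - p) * u) * ((1 - p) * v)" for p x u v :: "int fps"
    by algebra
  have "(1 - q) * ((1 - q) * crank_sum J m) = (\<Sum>j\<le>J. ?f j)"
    unfolding crank_sum_def sum_distrib_left t ipoch2_def ..
  also have "{..J} = insert 0 (insert 1 {2..J})" using assms by auto
  also have "(\<Sum>j\<in>insert 0 (insert 1 {2..J}). ?f j) = ?f 0 + (?f 1 + (\<Sum>j\<in>{2..J}. ?f j))"
    by (subst sum.insert, simp, simp, subst sum.insert) auto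
  also have "?f 0 = q ^ m * crank_head m"
  proof -
    have "0 + Suc 0 * (0 + m) = m" "0 + m = m" by simp_all
    thus ?thesis by (simp only: ipoch2_0 crank_head_def mult.assoc)
  qed
  also have "?f 1 = q ^ m * (q ^ (m + 3) * ipoch2 (Suc m))"
  proof -
    have "1 + Suc 1 * (1 + m) = m + (m + 3)" "1 + m = Suc m" "ipoch2 1 = 1" by (simp_all add: ipoch2_1)
    thus ?thesis by (simp only: power_add mult_1_right mult.assoc)
  qed
  finally show ?thesis by (simp only: distrib_left add.assoc)
qed

text \<open>The right-hand side for \<open>m = 5\<close> is found by clearing denominators and pairing each
  negative monomial with a factor \<open>1 - q ^ i\<close> of the denominator.\<close>

lemma crank_head_5: "crank_head 5 + q = geo 4 * geo 6 + q ^ 2 * geo 6 + q ^ 10 * geo 4 * geo 5 * geo 6 + q ^ 12 * geo 5 * geo 6"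
  and crank_head_4: "crank_head 4 = (1 - q + q ^ 2) * geo 4 * geo 6"
  and crank_head_3: "crank_head 3 = (1 - q + q ^ 2) * geo 6"
proof -
  have g: "(1 - q ^ 2) * geo 2 = 1" "(1 - q ^ 3) * geo 3 = 1" "(1 - q ^ 4) * geo 4 = 1"
    "(1 - q ^ 5) * geo 5 = 1" "(1 - q ^ 6) * geo 6 = 1"
    by (simp_all only: geo_inverse)
  have 0: "geo 2 = (1 + q ^ 2 + q ^ 4) * geo 6" using g(1,5) by algebra
  have 1: "(1 - q) * geo 2 * geo 3 = (1 - q + q ^ 2) * geo 6"
    unfolding 0 using g(2) by algebra
  show "crank_head 3 = (1 - q + q ^ 2) * geo 6"
    unfolding crank_head_def ipoch2_numerals 1[symmetric] by (simp only: mult.assoc)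
  show 4: "crank_head 4 = (1 - q + q ^ 2) * geo 4 * geo 6"
    unfolding crank_head_def ipoch2_numerals mult.assoc[symmetric] 1 by (simp only: mult_ac)
  have "crank_head 5 = crank_head 4 * geo 5"
    unfolding crank_head_def ipoch2_numerals by (simp only: mult.assoc)
  moreover have "(1 - q + q ^ 2) * geo 4 * geo 6 * geo 5 + q =
    geo 4 * geo 6 + q ^ 2 * geo 6 + q ^ 10 * geo 4 * geo 5 * geo 6 + q ^ 12 * geo 5 * geo 6"
    using g(3,4,5) by algebra
  ultimately show "crank_head 5 + q = geo 4 * geo 6 + q ^ 2 * geo 6 + q ^ 10 * geo 4 * geo 5 * geo 6 + q ^ 12 * geo 5 * geo 6"
    unfolding 4 by (simp only:)
qed

text \<open>A new part \<open>s\<close> repeats the coefficient \<open>-1\<close> of \<open>q\<close> at \<open>q ^ (s + 1)\<close>. If the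
  coefficient there is positive, the repetition is absorbed once and for all.\<close>

lemma mult_geo_above_minus_q:
  assumes "s \<ge> 1" "fps_nonneg (f + q)" "1 \<le> fps_nth f (Suc s)"
  shows "fps_nonneg (f * geo s + q)"
proof -
  have "(1 - q ^ s) * geo s = 1" by (rule geo_inverse) (use assms(1) in simp)
  moreover have "f * g + p = (f + p - p * x) * g" if "(1 - x) * g = 1" for f g x p :: "int fps"
    using that by algebra
  ultimately have "f * geo s + q = (f + q - q ^ Suc s) * geo s" unfolding power_Suc by blast
  moreover have "fps_nonneg (f + q - q ^ Suc s)"
    by (rule fps_nonneg_minus_X_power) (use assms in simp_all)
  ultimately show ?thesis by (simp only: fps_nonneg_mult fps_nonneg_geo)
qed

lemma above_minus_q_nth: "fps_nonneg (f + q) \<Longrightarrow> n \<noteq> 1 \<Longrightarrow> 0 \<le> fps_nth f n"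
  using fps_nonnegD[of "f + q" n] by simp

text \<open>Induction on \<open>m\<close> with the coefficient at \<open>m + 2\<close> in the hypothesis, which is what
  adding the part \<open>m + 1\<close> requires. At \<open>m = 7\<close> the parts are added in the order \<open>7, 6\<close>,
  because the coefficient of \<open>q ^ 7\<close> is \<open>0\<close> for \<open>m = 5\<close>: this is the reason why \<open>m = 6\<close> is
  exceptional.\<close>

lemma crank_head_large:
  assumes "m \<ge> 7"
  shows "fps_nonneg (crank_head m + q) \<and> 1 \<le> fps_nth (crank_head m) 2 \<and> 1 \<le> fps_nth (crank_head m) (m + 2)"
  using assms
proof (induction m rule: dec_induct)
  case base
  let ?A = "crank_head 5"
  have A: "fps_nonneg (?A + q)" unfolding crank_head_5 by (intro fps_nonneg_intros)
  have part: "fps_nonneg (geo 4 * geo 6)" "fps_nonneg (q ^ 2 * geo 6)"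
    "fps_nonneg (q ^ 10 * geo 4 * geo 5 * geo 6)" "fps_nonneg (q ^ 12 * geo 5 * geo 6)"
    by (intro fps_nonneg_intros)+
  have ge: "fps_nth (geo 4 * geo 6) n + fps_nth (q ^ 2 * geo 6) n \<le> fps_nth ?A n" if "n \<noteq> 1" for n
  proof -
    have "fps_nth (?A + q) n = fps_nth ?A n" using that by simp
    moreover have "fps_nth (geo 4 * geo 6) n + fps_nth (q ^ 2 * geo 6) n \<le> fps_nth (?A + q) n"
      unfolding crank_head_5 fps_add_nth using part(3,4) by (simp add: fps_nonneg_def)
    ultimately show ?thesis by simp
  qed
  have "fps_nth (geo 4) 8 * fps_nth (geo 6) 0 \<le> fps_nth (geo 4 * geo 6) (8 + 0)"
    by (intro nth_mult_ge fps_nonneg_geo)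
  hence A8: "1 \<le> fps_nth ?A (Suc 7)"
    using ge[of 8] fps_nonnegD[OF part(2), of 8] by (simp add: geo_nth)
  have A2: "1 \<le> fps_nth ?A 2"
    using ge[of 2] fps_nonnegD[OF part(1), of 2] by (simp add: fps_X_power_mult_nth geo_nth)
  have "fps_nth (geo 4) 0 * fps_nth (geo 6) 0 \<le> fps_nth (geo 4 * geo 6) (0 + 0)"
    by (intro nth_mult_ge fps_nonneg_geo)
  hence A0: "1 \<le> fps_nth ?A 0"
    using ge[of 0] fps_nonnegD[OF part(2), of 0] by (simp add: geo_nth)
  have A': "0 \<le> fps_nth ?A n" if "n \<noteq> 1" for n using above_minus_q_nth[OF A that] .
  \<comment> \<open>The part \<open>7\<close> is added first, to create a positive coefficient at \<open>q ^ 7\<close> for the part \<open>6\<close>.\<close>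
  have e: "crank_head 7 = ?A * geo 7 * geo 6" "crank_head 7 = ?A * geo 6 * geo 7"
    unfolding crank_head_def ipoch2_numerals by (simp_all only: mult_ac)
  have "fps_nonneg (?A * geo 7 + q)"
    by (rule mult_geo_above_minus_q[OF _ A A8]) simp
  moreover have "1 \<le> fps_nth (?A * geo 7) (Suc 6)"
  proof -
    have "fps_nth (?A * geo 7) 7 = fps_nth ?A 7 + fps_nth (?A * geo 7) 0"
      by (subst geo_mult_nth) simp_all
    also have "fps_nth (?A * geo 7) 0 = fps_nth ?A 0"
      by (subst geo_mult_nth) simp_all
    finally show ?thesis using A'[of 7] A0 by simp
  qed
  ultimately have "fps_nonneg (crank_head 7 + q)"
    unfolding e(1) by (rule mult_geo_above_minus_q[rotated]) simp
  moreover have B2: "fps_nth (?A * geo 6) 2 = fps_nth ?A 2"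
    by (subst geo_mult_nth) simp_all
  have C2: "fps_nth (?A * geo 6 * geo 7) 2 = fps_nth (?A * geo 6) 2"
    by (subst geo_mult_nth) simp_all
  have "fps_nth (?A * geo 6 * geo 7) 9 = fps_nth (?A * geo 6) 9 + fps_nth (?A * geo 6 * geo 7) 2"
    by (subst geo_mult_nth) simp_all
  moreover have "fps_nth (?A * geo 6) 9 = fps_nth ?A 9 + fps_nth (?A * geo 6) 3"
    by (subst geo_mult_nth) simp_all
  moreover have "fps_nth (?A * geo 6) 3 = fps_nth ?A 3"
    by (subst geo_mult_nth) simp_all
  ultimately show ?case
    using A2 A'[of 9] A'[of 3] B2 C2 unfolding e(2) by simp
next
  case (step m)
  hence IH: "fps_nonneg (crank_head m + q)" "1 \<le> fps_nth (crank_head m) 2" "1 \<le> fps_nth (crank_head m) (Suc (Suc m))"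
    by simp_all
  have "fps_nonneg (crank_head (Suc m) + q)"
    unfolding crank_head_Suc by (rule mult_geo_above_minus_q[OF _ IH(1,3)]) simp
  moreover have 2: "fps_nth (crank_head (Suc m)) 2 = fps_nth (crank_head m) 2"
    unfolding crank_head_Suc using step.hyps by (subst geo_mult_nth) simp_all
  moreover have "fps_nth (crank_head (Suc m)) (Suc m + 2) = fps_nth (crank_head m) (Suc m + 2) + fps_nth (crank_head (Suc m)) 2"
    unfolding crank_head_Suc by (subst geo_mult_nth) simp_all
  ultimately show ?case
    using IH(2) above_minus_q_nth[OF IH(1), of "Suc m + 2"] by simp
qed

text \<open>A bound for the negative part that remains after the terms \<open>j = 0\<close> and \<open>j = 1\<close> are
  added: besides the drop at \<open>n = m + 1\<close> it contains the sporadic exceptions for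
  \<open>m = 2, 3, 4, 6\<close>. In the other cases \<open>2 * q\<close> is a common bound, attained for \<open>m = 0\<close>.\<close>

definition crank_defect :: "nat \<Rightarrow> int fps" where
  "crank_defect m = q + (if m = 2 then q ^ 3 else if m = 3 \<or> m = 6 then q ^ 7
     else if m = 4 then q ^ 5 else q)"

text \<open>For \<open>m \<in> {2, 3, 4, 6}\<close> the first summand has further negative coefficients besides
  that of \<open>q\<close>; the second one, which comes from \<open>j = 1\<close>, compensates all but one of these.\<close>

lemma crank_main_positivity:
  "fps_nonneg (crank_head m + q ^ (m + 3) * ipoch2 (Suc m) + crank_defect m)"
proof -
  have g: "(1 - q ^ 2) * geo 2 = 1" "(1 - q ^ 3) * geo 3 = 1" "(1 - q ^ 4) * geo 4 = 1"
    "(1 - q ^ 5) * geo 5 = 1" "(1 - q ^ 6) * geo 6 = 1"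
    by (simp_all only: geo_inverse)
  have g26: "geo 2 = (1 + q ^ 2 + q ^ 4) * geo 6" using g(1,5) by algebra
  \<comment> \<open>\<open>1 / ((1 - q ^ 2) * (1 - q ^ 3))\<close> has the denominator \<open>(1 - q ^ 6) ^ 2\<close>; all but one power of it is hidden in \<open>W\<close>.\<close>
  define W where "W = q ^ 6 * (geo 2 * geo 3)"
  have W: "fps_nonneg W" unfolding W_def by (intro fps_nonneg_intros)
  have g36: "geo 3 = (1 + q ^ 3) * geo 6" using g(2,5) by algebra
  have g23: "geo 2 * geo 3 = (1 + q ^ 2 + q ^ 4) * (1 + q ^ 3) * geo 6 + W"
    unfolding W_def g26 g36 using g(5) by algebra
  have general: ?thesis if "fps_nonneg (crank_head m + q)" "m \<notin> {2, 3, 4, 6}"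
  proof -
    have "crank_head m + q ^ (m + 3) * ipoch2 (Suc m) + crank_defect m =
        (crank_head m + q) + (q ^ (m + 3) * ipoch2 (Suc m) + q)"
      using that(2) by (simp add: crank_defect_def)
    also have "fps_nonneg \<dots>"
      by (intro fps_nonneg_add that(1) fps_nonneg_mult fps_nonneg_power fps_nonneg_X fps_nonneg_ipoch2)
    finally show ?thesis .
  qed
  consider "m = 0" | "m = 1" | "m = 2" | "m = 3" | "m = 4" | "m = 5" | "m = 6" | "m \<ge> 7"
    by linarith
  thus ?thesis
  proof cases
    case 1
    have "crank_defect 0 = q + q" by (simp add: crank_defect_def)
    moreover have "(1 - q) * (1 - q) + q ^ 3 * 1 + (q + q) = 1 + q ^ 2 + q ^ 3" by algebra
    ultimately have "crank_head m + q ^ (m + 3) * ipoch2 (Suc m) + crank_defect m = 1 + q ^ 2 + q ^ 3"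
      unfolding 1 crank_head_def ipoch2_0 ipoch2_1 add_0 by (simp only:)
    thus ?thesis by (simp only: fps_nonneg_intros)
  next
    case 2
    have "crank_head m + q = 1" unfolding 2 crank_head_def One_nat_def ipoch2_1 by simp
    thus ?thesis using 2 by (intro general) (simp_all add: fps_nonneg_one)
  next
    case 3
    have n: "Suc 2 = 3" "2 + 3 = (5::nat)" by simp_all
    have "(1 - q) * geo 2 + q ^ 5 * (geo 2 * geo 3) + (q + q ^ 3) = geo 2 + q ^ 8 * geo 2 * geo 3"
      using g(1,2) by algebra
    moreover have "crank_defect 2 = q + q ^ 3" by (simp add: crank_defect_def)
    ultimately show ?thesis
      unfolding 3 n crank_head_def ipoch2_numerals by (simp only: fps_nonneg_intros)
  next
    case 4
    have n: "Suc 3 = 4" "3 + 3 = (6::nat)" by simp_all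
    have "(1 - q + q ^ 2) * geo 6 + q ^ 6 * (((1 + q ^ 2 + q ^ 4) * (1 + q ^ 3) * geo 6 + W) * geo 4) + (q + q ^ 7) =
        geo 6 + q ^ 2 * geo 6 + q ^ 6 * (1 + q ^ 2 + q ^ 3 + q ^ 4 + q ^ 5) * geo 6 * geo 4 + q ^ 17 * geo 6 * geo 4
        + q ^ 6 * W * geo 4"
      using g(3,5) by algebra
    moreover have "crank_defect 3 = q + q ^ 7" by (simp add: crank_defect_def)
    ultimately show ?thesis
      unfolding 4 n crank_head_3 ipoch2_numerals g23 by (simp only: fps_nonneg_intros W)
  next
    case 5
    have n: "Suc 4 = 5" "4 + 3 = (7::nat)" by simp_all
    have p1: "q ^ 7 * (geo 4 * geo 5 * geo 6) = q ^ 7 * (geo 4 * geo 6) + q ^ 12 * geo 4 * geo 5 * geo 6"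
      using g(4) by algebra
    have p2: "q * (geo 4 * geo 6) = q * geo 4 + q ^ 7 * (geo 4 * geo 6)"
      using g(5) by algebra
    have p3: "q * geo 4 = q + q ^ 5 + q ^ 9 * geo 4"
      using g(3) by algebra
    have p4: "q ^ 9 * (geo 4 * geo 5 * geo 6) = q ^ 9 * geo 4 + q ^ 9 * geo 4 * (q ^ 5 * geo 5 + q ^ 6 * geo 5 * geo 6)"
      using g(4,5) by algebra
    have lin: "(1 - q + q ^ 2) * x * z + q ^ 7 * (((1 + q ^ 2 + q ^ 4) * (1 + q ^ 3) * z + w) * x * y) + d =
      (1 + q ^ 2) * x * z - q * (x * z) + q ^ 7 * (x * y * z) + q ^ 9 * (x * y * z)
        + q ^ 7 * (q ^ 3 + q ^ 4 + q ^ 5 + q ^ 7) * x * y * z + q ^ 7 * w * x * y + d" for x y z w d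
      by algebra
    have lin': "u - (a + b + c + t) + (t + e) + (c + f) + r + w + (a + b) = u + e + f + r + w"
      for u a b c t e f r w :: "int fps"
      by algebra
    have "(1 - q + q ^ 2) * geo 4 * geo 6
        + q ^ 7 * (((1 + q ^ 2 + q ^ 4) * (1 + q ^ 3) * geo 6 + W) * geo 4 * geo 5) + (q + q ^ 5) =
      (1 + q ^ 2) * geo 4 * geo 6 + q ^ 12 * geo 4 * geo 5 * geo 6
        + q ^ 9 * geo 4 * (q ^ 5 * geo 5 + q ^ 6 * geo 5 * geo 6)
        + q ^ 7 * (q ^ 3 + q ^ 4 + q ^ 5 + q ^ 7) * geo 4 * geo 5 * geo 6
        + q ^ 7 * W * geo 4 * geo 5"
      unfolding lin p1 p4 p2 unfolding p3 by (rule lin')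
    moreover have "crank_defect 4 = q + q ^ 5" by (simp add: crank_defect_def)
    ultimately show ?thesis
      unfolding 5 n crank_head_4 ipoch2_numerals g23 by (simp only: fps_nonneg_intros W)
  next
    case 6
    have "fps_nonneg (crank_head 5 + q)" unfolding crank_head_5 by (intro fps_nonneg_intros)
    thus ?thesis using 6 by (intro general) simp_all
  next
    case 7
    \<comment> \<open>\<open>crank_head 6\<close> is bounded below by \<open>- q * geo 6\<close>, whose coefficients from \<open>q ^ 13\<close> on are absorbed by \<open>q ^ 9 * geo 6 * ?K\<close>.\<close>
    let ?K = "geo 4 * (geo 2 * geo 3 * geo 5 * geo 7)"
    have K: "fps_nonneg ?K" by (intro fps_nonneg_intros)
    have "1 \<le> fps_nth ?K 4"
    proof -
      have "fps_nth (geo 4) 4 * fps_nth (geo 2 * geo 3 * geo 5 * geo 7) 0 \<le> fps_nth ?K (4 + 0)"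
        by (intro nth_mult_ge fps_nonneg_intros)
      thus ?thesis by (simp add: geo_nth)
    qed
    with K have K4: "fps_nonneg (?K - q ^ 4)" by (rule fps_nonneg_minus_X_power)
    have n: "Suc 6 = 7" "6 + 3 = (9::nat)" by simp_all
    have A6: "crank_head 6 = crank_head 5 * geo 6"
      unfolding crank_head_def ipoch2_numerals by (simp only: mult.assoc)
    have d: "crank_defect 6 = q + q ^ 7" by (simp add: crank_defect_def)
    have "a * geo 6 + q ^ 9 * (x * geo 6) + (q + q ^ 7) =
        (a + q) * geo 6 + q ^ 9 * geo 6 * (x - q ^ 4)" for a x
      using g(5) by algebra
    moreover have "ipoch2 7 = ?K * geo 6" unfolding ipoch2_numerals by (simp only: mult_ac)
    ultimately have e: "crank_head 6 + q ^ 9 * ipoch2 7 + crank_defect 6 =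
        (crank_head 5 + q) * geo 6 + q ^ 9 * geo 6 * (?K - q ^ 4)"
      unfolding A6 d by (simp only:)
    have "fps_nonneg (crank_head 5 + q)" unfolding crank_head_5 by (intro fps_nonneg_intros)
    thus ?thesis
      unfolding 7 n e
      by (rule fps_nonneg_add[OF fps_nonneg_mult[OF _ fps_nonneg_geo]
            fps_nonneg_mult[OF fps_nonneg_mult[OF fps_nonneg_power[OF fps_nonneg_X] fps_nonneg_geo] K4]])
  next
    case 8
    thus ?thesis using crank_head_large[OF 8] by (intro general) auto
  qed
qed

lemma crank_rest:
  shows "fps_nonneg (\<Sum>j\<in>{2..J}. q ^ (j + Suc j * (j + m)) * ipoch2 j * ipoch2 (j + m))"
    and "q ^ (3 * m + 8) dvd (\<Sum>j\<in>{2..J}. q ^ (j + Suc j * (j + m)) * ipoch2 j * ipoch2 (j + m))"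
proof -
  have ipoch2: "fps_nonneg (ipoch2 j)" if "j \<ge> 2" for j
    using fps_nonneg_ipoch2[of "j - 1"] that by simp
  show "fps_nonneg (\<Sum>j\<in>{2..J}. q ^ (j + Suc j * (j + m)) * ipoch2 j * ipoch2 (j + m))"
    by (intro fps_nonneg_sum fps_nonneg_mult fps_nonneg_power fps_nonneg_X ipoch2) auto
  show "q ^ (3 * m + 8) dvd (\<Sum>j\<in>{2..J}. q ^ (j + Suc j * (j + m)) * ipoch2 j * ipoch2 (j + m))"
  proof (rule dvd_sum)
    fix j assume "j \<in> {2..J}"
    hence j: "2 \<le> j" by simp
    hence "3 * (2 + m) \<le> Suc j * (j + m)" by (intro mult_le_mono) auto
    hence "3 * m + 8 \<le> j + Suc j * (j + m)" using j by simp
    thus "q ^ (3 * m + 8) dvd q ^ (j + Suc j * (j + m)) * ipoch2 j * ipoch2 (j + m)"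
      by (rule dvd_mult2[OF dvd_mult2[OF le_imp_power_dvd]])
  qed
qed

lemma crank_pos:
  assumes "J \<ge> 1" "n \<noteq> m + 1" "(m, n) \<notin> {(2, 5), (3, 10), (4, 9), (6, 13)}"
  shows "0 \<le> fps_nth ((1 - q) * ((1 - q) * crank_sum J m)) n"
proof -
  let ?M = "crank_head m + q ^ (m + 3) * ipoch2 (Suc m)"
  have "0 \<le> fps_nth (q ^ m * ?M) n"
  proof (cases "n < m")
    case False
    then obtain d where d: "n = m + d" by (metis le_Suc_ex not_less)
    have "fps_nth (crank_defect m) d = 0"
      using assms(2,3) unfolding d
      by (auto simp: crank_defect_def fps_X_power_nth fps_X_nth split: if_splits)
    hence "fps_nth (crank_defect m) (n - m) = 0" using d by simp
    hence "0 \<le> fps_nth ?M (n - m)"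
      using fps_nonnegD[OF crank_main_positivity[of m], of "n - m"] by (simp only: fps_add_nth)
    thus ?thesis using False by (simp only: fps_X_power_mult_nth if_False)
  qed (simp only: fps_X_power_mult_nth if_True)
  thus ?thesis
    unfolding crank_split[OF assms(1)] fps_add_nth[of "q ^ m * _"]
    by (intro add_nonneg_nonneg fps_nonnegD[OF crank_rest(1)])
qed

lemma ipoch2_low: "fps_nth (ipoch2 (Suc m)) 0 = 1 \<and> fps_nth (ipoch2 (Suc m)) 1 = 0"
proof (induction m)
  case (Suc m)
  have "fps_nth (ipoch2 (Suc (Suc m))) n = fps_nth (ipoch2 (Suc m)) n" if "n < 2" for n
    unfolding ipoch2_Suc_Suc using that by (subst geo_mult_nth) auto
  thus ?case using Suc by simp
qed (simp add: ipoch2_1)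

lemma crank_drop:
  assumes "J \<ge> 1"
  shows "fps_nth ((1 - q) * ((1 - q) * crank_sum J m)) (m + 1) < 0"
proof -
  have "fps_nth (\<Sum>j\<in>{2..J}. q ^ (j + Suc j * (j + m)) * ipoch2 j * ipoch2 (j + m)) (m + 1) = 0"
    using crank_rest(2)[of m J] unfolding X_power_dvd_iff by simp
  moreover have "fps_nth (q ^ m * (crank_head m + q ^ (m + 3) * ipoch2 (Suc m))) (m + 1) = fps_nth (crank_head m) 1"
    by (simp only: fps_X_power_mult_nth fps_add_nth) simp
  moreover have "fps_nth (crank_head m) 1 < 0"
  proof (cases m)
    case 0
    thus ?thesis by (simp add: crank_head_def ipoch2_0 one_minus_q_mult_nth)
  next
    case (Suc m')
    thus ?thesis using ipoch2_low[of m'] by (simp add: crank_head_def one_minus_q_mult_nth)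
  qed
  ultimately show ?thesis unfolding crank_split[OF assms] by (simp only: fps_add_nth add_0_right)
qed

section \<open>The sporadic exceptions and the characterisation of all decreases\<close>

lemma tail_nth_eq_0:
  assumes "n < a * a + i + m"
  shows "fps_nth (\<Sum>j\<in>{a..J}. q ^ (j * j) * beta_diff i j m) n = 0"
proof -
  have "q ^ (a * a + (i + m)) dvd (\<Sum>j\<in>{a..J}. q ^ (j * j) * beta_diff i j m)"
  proof (rule dvd_sum)
    fix j assume "j \<in> {a..J}"
    hence "a * a \<le> j * j" by (intro mult_le_mono) auto
    hence "q ^ (a * a) dvd q ^ (j * j)" by (rule le_imp_power_dvd)
    thus "q ^ (a * a + (i + m)) dvd q ^ (j * j) * beta_diff i j m"
      unfolding power_add[of q "a * a"] beta_diff_def by (intro mult_dvd_mono dvd_mult bailey_beta_order)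
  qed
  thus ?thesis using assms unfolding X_power_dvd_iff by simp
qed

lemma krank_2_exceptions:
  assumes "2 \<le> J" "(m, n) \<in> {(1, 7), (0, 8), (3, 11)}"
  shows "fps_nth (\<Sum>j\<in>{1..J}. q ^ (j * j) * beta_diff 0 j m) n < 0"
proof -
  have t: "fps_nth (\<Sum>j\<in>{3..J}. q ^ (j * j) * beta_diff 0 j m) n = 0"
    by (rule tail_nth_eq_0) (use assms(2) in auto)
  have g: "fps_nth (geo 3 * geo 4) 2 = 0"
    by (subst geo_mult_nth) (simp_all add: geo_nth)
  have "fps_nth (rank_core (m + 1)) (n - (m + 1) - 3) \<le> 0"
  proof -
    consider "m = 1" "n = 7" | "m = 0" "n = 8" | "m = 3" "n = 11" using assms(2) by auto
    thus ?thesis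
    proof cases
      case 1
      have e: "1 + 1 = (2::nat)" "7 - 2 - 3 = (2::nat)" by simp_all
      show ?thesis unfolding 1 e rank_core_expand g by simp
    next
      case 2
      have e: "0 + 1 = (1::nat)" "8 - 1 - 3 = (4::nat)" by simp_all
      show ?thesis unfolding 2 e rank_core_1_nth by simp
    next
      case 3
      have e: "3 + 1 = (4::nat)" "11 - 4 - 3 = (4::nat)" by simp_all
      show ?thesis unfolding 3 e rank_core_expand fps_add_nth fps_X_power_mult_nth geo_nth using g by simp
    qed
  qed
  moreover have "odd (n - (m + 1))" "3 \<le> n - (m + 1)" "\<not> n < m + 1" using assms(2) by auto
  ultimately have "fps_nth (q ^ (m + 1) * ((1 - q) * geo 2 + q ^ 3 * rank_core (m + 1))) n < 0"
    unfolding fps_X_power_mult_nth rank_main_nth by simp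
  thus ?thesis unfolding chain_sum_2[OF assms(1)] fps_add_nth t by (simp only: add_0_right)
qed

lemma krank_3_exception:
  assumes "2 \<le> J"
  shows "fps_nth (\<Sum>j\<in>{1..J}. q ^ (j * j) * beta_diff (Suc 0) j 0) 9 < 0"
proof -
  have t: "fps_nth (\<Sum>j\<in>{3..J}. q ^ (j * j) * beta_diff (Suc 0) j 0) 9 = 0"
    by (rule tail_nth_eq_0) simp
  have e: "0 + 0 + 2 = (2::nat)" "0 + 1 = (1::nat)" by simp_all
  have "fps_nth (q ^ 8 * beta_diff 0 2 0) 9 = fps_nth (rank_core 1) 1"
    unfolding beta_diff_2 rank_core_def[symmetric] e by (simp only: fps_X_power_mult_nth power_0 mult_1) simp
  also have "\<dots> = -1" unfolding rank_core_1_nth by simp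
  finally have 1: "fps_nth (q ^ 8 * beta_diff 0 2 0) 9 = -1" .
  have "fps_nth (q ^ 2 * (geo 2 - q)) 9 = 0"
    by (simp only: fps_X_power_mult_nth fps_sub_nth geo_nth fps_X_nth) simp
  thus ?thesis unfolding chain_sum_ge_3[OF assms] e fps_add_nth t 1 by simp
qed

lemma geo_4_6_low: "n < 6 \<Longrightarrow> fps_nth (geo 4 * geo 6) n = fps_nth (geo 4) n"
  by (subst geo_mult_nth) simp_all

lemma crank_exceptions:
  assumes "J \<ge> 1" "(m, n) \<in> {(2, 5), (3, 10), (4, 9), (6, 13)}"
  shows "fps_nth ((1 - q) * ((1 - q) * crank_sum J m)) n < 0"
proof -
  have t: "fps_nth (\<Sum>j\<in>{2..J}. q ^ (j + Suc j * (j + m)) * ipoch2 j * ipoch2 (j + m)) n = 0"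
    using crank_rest(2)[of m J] assms(2) unfolding X_power_dvd_iff by auto
  have "fps_nth (q ^ (m + 3) * ipoch2 (Suc m)) (n - m) = 0"
    using assms(2) ipoch2_low[of m] unfolding fps_X_power_mult_nth by auto
  moreover have "fps_nth (crank_head m) (n - m) < 0"
  proof -
    have pm: "fps_nth ((1 - q + q ^ 2) * f) n = fps_nth f n - (if n < 1 then 0 else fps_nth f (n - 1))
        + (if n < 2 then 0 else fps_nth f (n - 2))" for f n
    proof -
      have "(1 - q + q ^ 2) * f = f - q ^ 1 * f + q ^ 2 * f" by algebra
      thus ?thesis by (simp only: fps_add_nth fps_sub_nth fps_X_power_mult_nth)
    qed
    consider "m = 2" "n = 5" | "m = 3" "n = 10" | "m = 4" "n = 9" | "m = 6" "n = 13"
      using assms(2) by auto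
    thus ?thesis
    proof cases
      case 1
      have e: "5 - 2 = (3::nat)" by simp
      show ?thesis unfolding 1 e crank_head_def ipoch2_numerals one_minus_q_mult_nth geo_nth by simp
    next
      case 2
      have e: "10 - 3 = (7::nat)" by simp
      show ?thesis unfolding 2 e crank_head_3 pm geo_nth by simp
    next
      case 3
      have e: "9 - 4 = (5::nat)" by simp
      show ?thesis unfolding 3 e crank_head_4 mult.assoc pm by (simp add: geo_4_6_low geo_nth)
    next
      case 4
      have A6: "crank_head 6 = crank_head 5 * geo 6"
        unfolding crank_head_def ipoch2_numerals by (simp only: mult.assoc)
      have n5: "fps_nth (crank_head 5) n = fps_nth (geo 4 * geo 6) n + fps_nth (q ^ 2 * geo 6) n
          - fps_nth q n" if "n < 10" for n
      proof -
        have "crank_head 5 = geo 4 * geo 6 + q ^ 2 * geo 6 + q ^ 10 * (geo 4 * geo 5 * geo 6)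
            + q ^ 12 * (geo 5 * geo 6) - q"
          using crank_head_5 by algebra
        thus ?thesis using that
          by (simp only: fps_add_nth fps_sub_nth fps_X_power_mult_nth[of 10] fps_X_power_mult_nth[of 12]) simp
      qed
      have 1: "fps_nth (crank_head 5) 1 = -1"
        by (subst n5) (simp_all add: geo_4_6_low fps_X_power_mult_nth geo_nth)
      have "fps_nth (geo 4 * geo 6) 7 = fps_nth (geo 4) 7 + fps_nth (geo 4 * geo 6) 1"
        by (subst geo_mult_nth) simp_all
      hence "fps_nth (geo 4 * geo 6) 7 = 0" by (simp add: geo_4_6_low geo_nth)
      hence 7: "fps_nth (crank_head 5) 7 = 0"
        by (subst n5) (simp_all add: fps_X_power_mult_nth geo_nth)
      have "fps_nth (crank_head 5 * geo 6) 7 = fps_nth (crank_head 5) 7 + fps_nth (crank_head 5 * geo 6) 1"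
        by (subst geo_mult_nth) simp_all
      also have "fps_nth (crank_head 5 * geo 6) 1 = fps_nth (crank_head 5) 1"
        by (subst geo_mult_nth) simp_all
      finally have "fps_nth (crank_head 6) 7 = -1" unfolding A6 1 7 by simp
      thus ?thesis unfolding 4 by simp
    qed
  qed
  moreover have "\<not> n < m" using assms(2) by auto
  ultimately have "fps_nth (q ^ m * (crank_head m + q ^ (m + 3) * ipoch2 (Suc m))) n < 0"
    unfolding fps_X_power_mult_nth[of m] fps_add_nth by simp
  thus ?thesis unfolding crank_split[OF assms(1)] fps_add_nth[of "q ^ m * _"] t by (simp only: add_0_right)
qed

lemma krank_N_1_diff:
  "krank_N 1 (int m) (int n) - krank_N 1 (int m) (int n - 1)
     = fps_nth ((1 - q) * ((1 - q) * crank_sum (Suc n) m)) n"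
proof -
  have "q ^ Suc n dvd (1 - q) * krank_gf 1 (int m) - (1 - q) * ((1 - q) * crank_sum (Suc n) m)"
    unfolding right_diff_distrib[symmetric] by (rule dvd_mult[OF crank_gf])
  thus ?thesis unfolding krank_N_diff by (rule X_cong_nth) simp
qed

lemma krank_1_monotone_iff:
  "krank_N 1 (int m) (int n - 1) \<le> krank_N 1 (int m) (int n) \<longleftrightarrow>
    \<not> (n = m + 1 \<or> (m, n) \<in> {(2, 5), (3, 10), (4, 9), (6, 13)})"
proof -
  have "0 \<le> fps_nth ((1 - q) * ((1 - q) * crank_sum (Suc n) m)) n \<longleftrightarrow>
    \<not> (n = m + 1 \<or> (m, n) \<in> {(2, 5), (3, 10), (4, 9), (6, 13)})"
  proof (cases "n = m + 1 \<or> (m, n) \<in> {(2, 5), (3, 10), (4, 9), (6, 13)}")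
    case True
    have J: "1 \<le> Suc n" by simp
    from True have "fps_nth ((1 - q) * ((1 - q) * crank_sum (Suc n) m)) n < 0"
    proof
      assume "n = m + 1"
      thus ?thesis using crank_drop[OF J, of m] by (simp only:)
    qed (rule crank_exceptions[OF J])
    thus ?thesis using True by (simp only: not_le[symmetric] not_True_eq_False)
  next
    case False
    thus ?thesis using crank_pos[of "Suc n" n m] by simp
  qed
  thus ?thesis unfolding krank_N_1_diff[symmetric] diff_ge_0_iff_ge .
qed

lemma krank_2_monotone_iff:
  "krank_N 2 (int m) (int n - 1) \<le> krank_N 2 (int m) (int n) \<longleftrightarrow>
    \<not> (n = m + 2 \<or> (m, n) \<in> {(1, 7), (0, 8), (3, 11)})"
proof -
  let ?S = "\<Sum>j\<in>{1..n + 2}. q ^ (j * j) * beta_diff 0 j m"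
  have J: "2 \<le> n + 2" "1 \<le> n + 2" by simp_all
  have d: "krank_N 2 (int m) (int n) - krank_N 2 (int m) (int n - 1) = fps_nth ?S n"
    using krank_N_diff_bailey_chain[of n "n + 2" 0 m] by simp
  have "0 \<le> fps_nth ?S n \<longleftrightarrow> \<not> (n = m + 2 \<or> (m, n) \<in> {(1, 7), (0, 8), (3, 11)})"
  proof (cases "n = m + 2 \<or> (m, n) \<in> {(1, 7), (0, 8), (3, 11)}")
    case True
    hence "fps_nth ?S n < 0"
    proof
      assume "n = m + 2"
      hence "n = 0 + m + 2" by simp
      thus ?thesis using krank_drop_at_exception[OF J(2), of 0 m] by (simp only:)
    qed (rule krank_2_exceptions[OF J(1)])
    thus ?thesis using True by simp
  next
    case False
    have "0 \<le> fps_nth ?S n"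
    proof (cases "m = 0")
      case True
      have "n \<noteq> 2" "n \<noteq> 8" using True False by auto
      thus ?thesis unfolding True by (rule krank_2_pos_0[OF J(1)])
    next
      case m: False
      show ?thesis by (rule krank_2_pos[OF J(1)]) (use m False in auto)
    qed
    thus ?thesis using False by simp
  qed
  thus ?thesis unfolding d[symmetric] diff_ge_0_iff_ge .
qed

lemma krank_ge_3_monotone_iff:
  "krank_N (int i + 3) (int m) (int n - 1) \<le> krank_N (int i + 3) (int m) (int n) \<longleftrightarrow>
    \<not> (n = m + i + 3 \<or> (i = 0 \<and> m = 0 \<and> n = 9))"
proof -
  let ?S = "\<Sum>j\<in>{1..n + 4}. q ^ (j * j) * beta_diff (Suc i) j m"
  have J: "4 \<le> n + 4" "2 \<le> n + 4" "1 \<le> n + 4" by simp_all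
  have k: "int i + 3 = int (Suc (Suc (Suc i)))" by simp
  have d: "krank_N (int i + 3) (int m) (int n) - krank_N (int i + 3) (int m) (int n - 1) = fps_nth ?S n"
    unfolding k by (rule krank_N_diff_bailey_chain) simp
  have "0 \<le> fps_nth ?S n \<longleftrightarrow> \<not> (n = m + i + 3 \<or> (i = 0 \<and> m = 0 \<and> n = 9))"
  proof (cases "n = m + i + 3 \<or> (i = 0 \<and> m = 0 \<and> n = 9)")
    case True
    hence "fps_nth ?S n < 0"
    proof
      assume "n = m + i + 3"
      hence "n = Suc i + m + 2" by simp
      thus ?thesis using krank_drop_at_exception[OF J(3), of "Suc i" m] by (simp only:)
    next
      assume "i = 0 \<and> m = 0 \<and> n = 9"
      thus ?thesis using krank_3_exception[of "n + 4"] J(2) by (simp only:)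
    qed
    thus ?thesis using True by simp
  next
    case False
    have "0 \<le> fps_nth ?S n"
    proof (cases m)
      case 0
      show ?thesis unfolding 0 by (rule krank_ge_3_pos_0[OF J(1)]) (use 0 False in auto)
    next
      case (Suc m')
      show ?thesis unfolding Suc by (rule krank_ge_3_pos[OF J(2)]) (use Suc False in auto)
    qed
    thus ?thesis using False by simp
  qed
  thus ?thesis unfolding d[symmetric] diff_ge_0_iff_ge .
qed

theorem corollary1p9:
  fixes k m n :: int
  assumes "k \<ge> 1" and "m \<ge> 0" and "n \<ge> k - 1"
  shows "krank_N k m n \<ge> krank_N k m (n - 1) \<longleftrightarrow>
    \<not> (n = m + k \<or>
       (k, m, n) \<in> {(1, 2, 5), (1, 3, 10), (1, 4, 9), (1, 6, 13),
                    (2, 1, 7), (2, 0, 8), (2, 3, 11), (3, 0, 9)})"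
proof -
  obtain m' n' where mn: "m = int m'" "n = int n'"
    using assms by (metis add.commute diff_add_cancel nonneg_int_cases order_trans zle_diff1_eq
        zero_le_imp_eq_int diff_ge_0_iff_ge)
  consider "k = 1" | "k = 2" | "k \<ge> 3" using assms(1) by linarith
  thus ?thesis
  proof cases
    case 1
    show ?thesis unfolding 1 mn krank_1_monotone_iff by auto
  next
    case 2
    show ?thesis unfolding 2 mn krank_2_monotone_iff by auto
  next
    case 3
    then obtain i where "k - 3 = int i" by (metis diff_ge_0_iff_ge nonneg_int_cases)
    hence k: "k = int i + 3" by simp
    show ?thesis unfolding k mn krank_ge_3_monotone_iff by auto
  qed
qed

end
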